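(* Let $2 \le n \in \mathbb{N}$ and $T \in \mathcal{B}(\mathbb{C}^n)$. The following are equivalent. (a) $T = MN - NM$ for some $M, N \in \mathcal{B}(\mathbb{C}^n)$ with $M^2 = 0 = N^2$. (b) There exist an integer $k$ with $0 \le 2k \le n$, an invertible operator $A \in \mathcal{B}(\mathbb{C}^k)$ and a nilpotent operator $L \in \mathcal{B}(\mathbb{C}^{n-2k})$ such that $T$ is similar to $(A \oplus -A) \oplus L^2$.
   Context: Two operators $X, Y$ are similar if $Y = S^{-1} X S$ for some invertible $S$. When $k = 0$ the summand $A \oplus -A$ is absent, and when $2k = n$ the summand $L^2$ is absent. *)

theory Defs
  imports "Jordan_Normal_Form.Matrix"
begin

definition dsum_mat :: "'a::zero mat \<Rightarrow> 'a mat \<Rightarrow> 'a mat" (infixl \<open>\<oplus>\<^sub>m\<close> 65) where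
  "A \<oplus>\<^sub>m B = four_block_mat A (0\<^sub>m (dim_row A) (dim_col B)) (0\<^sub>m (dim_row B) (dim_col A)) B"

definition nilpotent_mat :: "'a::semiring_1 mat \<Rightarrow> bool" where
  "nilpotent_mat L \<longleftrightarrow> (\<exists>m. L ^\<^sub>m m = 0\<^sub>m (dim_row L) (dim_col L))"

end

theory Submission
  imports Defs "Jordan_Normal_Form.Jordan_Normal_Form_Existence" "Jordan_Normal_Form.Jordan_Normal_Form_Uniqueness"
begin

text \<open>Let \<open>T = M N - N M\<close> with \<open>M\<^sup>2 = N\<^sup>2 = 0\<close>. Both \<open>M\<close> and \<open>N\<close> anticommute with \<open>T\<close>, hence they respect the
  Fitting decomposition of \<open>T\<close>. On the invertible part \<open>M + N\<close> is invertible, because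
  \<open>(M - N) (M + N) = T\<close>, and it conjugates \<open>T\<close> into \<open>- T\<close>; so the Jordan blocks for \<open>a\<close> and \<open>- a\<close> match.

  On the nilpotent part, \<open>T\<close> is a square of a nilpotent matrix iff its block sizes can be grouped into
  pairs differing by at most one, i.e. iff for each \<open>l\<close> that is not a block size the number of blocks
  larger than \<open>l\<close> is even. That number is the dimension of
  \<open>E = ker T \<inter> im T\<^bsup>l\<^esup> = ker T \<inter> im T\<^bsup>l - 1\<^esup>\<close>. On \<open>E\<close> the maps \<open>P\<close>, \<open>Q\<close> induced by \<open>M\<close>, \<open>N\<close> commute
  and square to zero, and lifting through \<open>T\<^bsup>l\<^esup>\<close> yields maps \<open>m\<close>, \<open>n\<close> with
  \<open>P n + n P - m Q - Q m = 1\<close> and \<open>n Q = Q n\<close>. On \<open>ker Q / im Q\<close> this reads \<open>P n + n P = 1\<close>, so this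
  quotient, and with it \<open>E\<close>, is even-dimensional. Evenness is extracted by writing the trace of the
  projection onto \<open>E\<close> as twice a sum of traces of idempotents.

  Conversely \<open>A \<oplus> - A\<close> and the squares of nilpotent Jordan blocks are explicit commutators.\<close>

subsection \<open>Direct sums and Jordan matrices\<close>

lemma dsum_mat_carrier [simp]:
  "A \<in> carrier_mat m m' \<Longrightarrow> B \<in> carrier_mat n n' \<Longrightarrow> A \<oplus>\<^sub>m B \<in> carrier_mat (m + n) (m' + n')"
  unfolding dsum_mat_def by auto

lemma dsum_mat_dim [simp]:
  "dim_row (A \<oplus>\<^sub>m B) = dim_row A + dim_row B" "dim_col (A \<oplus>\<^sub>m B) = dim_col A + dim_col B"
  unfolding dsum_mat_def by auto

lemma dsum_mat_mult:
  fixes A :: "'a :: semiring_1 mat"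
  assumes "A \<in> carrier_mat m m" "C \<in> carrier_mat m m" "B \<in> carrier_mat n n" "D \<in> carrier_mat n n"
  shows "(A \<oplus>\<^sub>m B) * (C \<oplus>\<^sub>m D) = (A * C) \<oplus>\<^sub>m (B * D)"
proof -
  have "(A \<oplus>\<^sub>m B) * (C \<oplus>\<^sub>m D) = four_block_mat A (0\<^sub>m m n) (0\<^sub>m n m) B * four_block_mat C (0\<^sub>m m n) (0\<^sub>m n m) D"
    unfolding dsum_mat_def using assms by auto
  also have "\<dots> = four_block_mat (A * C + 0\<^sub>m m n * 0\<^sub>m n m) (A * 0\<^sub>m m n + 0\<^sub>m m n * D)
      (0\<^sub>m n m * C + B * 0\<^sub>m n m) (0\<^sub>m n m * 0\<^sub>m m n + B * D)"
    by (rule mult_four_block_mat) (use assms in auto)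
  also have "\<dots> = (A * C) \<oplus>\<^sub>m (B * D)"
    unfolding dsum_mat_def using assms by auto
  finally show ?thesis .
qed

lemma dsum_mat_add:
  fixes A :: "'a :: semiring_1 mat"
  assumes "A \<in> carrier_mat m m" "C \<in> carrier_mat m m" "B \<in> carrier_mat n n" "D \<in> carrier_mat n n"
  shows "(A \<oplus>\<^sub>m B) + (C \<oplus>\<^sub>m D) = (A + C) \<oplus>\<^sub>m (B + D)"
  using assms unfolding dsum_mat_def by (intro eq_matI) auto

lemma dsum_mat_minus:
  fixes A :: "'a :: ring_1 mat"
  assumes "A \<in> carrier_mat m m" "C \<in> carrier_mat m m" "B \<in> carrier_mat n n" "D \<in> carrier_mat n n"
  shows "(A \<oplus>\<^sub>m B) - (C \<oplus>\<^sub>m D) = (A - C) \<oplus>\<^sub>m (B - D)"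
  using assms unfolding dsum_mat_def by (intro eq_matI) auto

lemma dsum_mat_pow:
  fixes A :: "'a :: semiring_1 mat"
  assumes "A \<in> carrier_mat m m" "B \<in> carrier_mat n n"
  shows "(A \<oplus>\<^sub>m B) ^\<^sub>m k = (A ^\<^sub>m k) \<oplus>\<^sub>m (B ^\<^sub>m k)"
  using pow_four_block_mat[OF assms, of k] assms unfolding dsum_mat_def by simp

lemma dsum_mat_zero: "0\<^sub>m m m' \<oplus>\<^sub>m 0\<^sub>m n n' = 0\<^sub>m (m + n) (m' + n')"
  unfolding dsum_mat_def by simp

lemma dsum_mat_one: "1\<^sub>m m \<oplus>\<^sub>m 1\<^sub>m n = 1\<^sub>m (m + n)"
  unfolding dsum_mat_def by simp

lemma dsum_mat_assoc: "(A \<oplus>\<^sub>m B) \<oplus>\<^sub>m C = A \<oplus>\<^sub>m (B \<oplus>\<^sub>m C)"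
  using assoc_four_block_mat[of A B C] unfolding dsum_mat_def by simp

lemma dsum_mat_empty [simp]: "A \<oplus>\<^sub>m 0\<^sub>m 0 0 = A" "0\<^sub>m 0 0 \<oplus>\<^sub>m A = A"
  unfolding dsum_mat_def by (intro eq_matI; auto)+

lemma dsum_mat_eq_iff:
  assumes "A \<in> carrier_mat m m" "C \<in> carrier_mat m m" "B \<in> carrier_mat n n" "D \<in> carrier_mat n n"
  shows "A \<oplus>\<^sub>m B = C \<oplus>\<^sub>m D \<longleftrightarrow> A = C \<and> B = D"
proof (intro iffI conjI)
  assume eq: "A \<oplus>\<^sub>m B = C \<oplus>\<^sub>m D"
  show "A = C"
  proof (rule eq_matI)
    fix i j assume "i < dim_row C" "j < dim_col C"
    then show "A $$ (i,j) = C $$ (i,j)"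
      using arg_cong[OF eq, of "\<lambda>X. X $$ (i,j)"] assms by (auto simp: dsum_mat_def)
  qed (use assms in auto)
  show "B = D"
  proof (rule eq_matI)
    fix i j assume "i < dim_row D" "j < dim_col D"
    then show "B $$ (i,j) = D $$ (i,j)"
      using arg_cong[OF eq, of "\<lambda>X. X $$ (m + i,m + j)"] assms by (auto simp: dsum_mat_def)
  qed (use assms in auto)
qed auto

lemma similar_mat_dsum:
  assumes "similar_mat A C" "similar_mat B D"
  shows "similar_mat (A \<oplus>\<^sub>m B) (C \<oplus>\<^sub>m D)"
proof -
  obtain m where m: "{A,C} \<subseteq> carrier_mat m m" using similar_matD[OF assms(1)] by fast
  obtain n where n: "{B,D} \<subseteq> carrier_mat n n" using similar_matD[OF assms(2)] by fast
  show ?thesis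
    using similar_mat_four_block_0_0[OF assms, of m n] m n unfolding dsum_mat_def by auto
qed

lemma similar_mat_dsum_commute:
  fixes A :: "'a :: semiring_1 mat"
  assumes A: "A \<in> carrier_mat m m" and B: "B \<in> carrier_mat n n"
  shows "similar_mat (A \<oplus>\<^sub>m B) (B \<oplus>\<^sub>m A)"
proof -
  define P where "P = four_block_mat (0\<^sub>m m n) (1\<^sub>m m) (1\<^sub>m n) (0\<^sub>m n m :: 'a mat)"
  define Q where "Q = four_block_mat (0\<^sub>m n m) (1\<^sub>m n) (1\<^sub>m m) (0\<^sub>m m n :: 'a mat)"
  have P: "P \<in> carrier_mat (m + n) (n + m)" and Q: "Q \<in> carrier_mat (n + m) (m + n)"
    unfolding P_def Q_def by auto
  have PQ: "P * Q = 1\<^sub>m (m + n)" unfolding P_def Q_def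
    by (subst mult_four_block_mat[where ?nr1.0=m and ?n1.0=n and ?n2.0=m and ?nr2.0=n and ?nc1.0=m and ?nc2.0=n]) auto
  have QP: "Q * P = 1\<^sub>m (n + m)" unfolding P_def Q_def
    by (subst mult_four_block_mat[where ?nr1.0=n and ?n1.0=m and ?n2.0=n and ?nr2.0=m and ?nc1.0=n and ?nc2.0=m]) auto
  have "P * (B \<oplus>\<^sub>m A) = four_block_mat (0\<^sub>m m n) A B (0\<^sub>m n m)"
    unfolding P_def dsum_mat_def using A B
    by (subst mult_four_block_mat[where ?nr1.0=m and ?n1.0=n and ?n2.0=m and ?nr2.0=n and ?nc1.0=n and ?nc2.0=m]) auto
  then have "P * (B \<oplus>\<^sub>m A) * Q = A \<oplus>\<^sub>m B"
    unfolding Q_def dsum_mat_def using A B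
    by (simp, subst mult_four_block_mat[where ?nr1.0=m and ?n1.0=n and ?n2.0=m and ?nr2.0=n and ?nc1.0=m and ?nc2.0=n]) auto
  then show ?thesis
    using A B P Q PQ QP by (intro similar_matI[of _ _ P Q "m + n"]) (auto simp: add.commute)
qed

section \<open>Jordan matrices as direct sums, up to the order of their blocks\<close>

lemma jordan_matrix_Cons_dsum: "jordan_matrix ((m, a) # xs) = jordan_block m a \<oplus>\<^sub>m jordan_matrix xs"
  unfolding jordan_matrix_Cons dsum_mat_def by simp

lemma jordan_matrix_Nil [simp]: "jordan_matrix [] = 0\<^sub>m 0 0"
  by (simp add: jordan_matrix_def)

lemma jordan_matrix_append: "jordan_matrix (xs @ ys) = jordan_matrix xs \<oplus>\<^sub>m jordan_matrix ys"
  by (induction xs) (auto simp: jordan_matrix_Cons_dsum dsum_mat_assoc)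

text \<open>The head block of \<open>xs\<close> is located inside \<open>ys\<close> and moved past
  the prefix \<open>us\<close> by one block swap; the other blocks match by induction. Blocks can
  then be regrouped freely by eigenvalue or by size.\<close>

lemma similar_mat_jordan_matrix_mset:
  fixes xs ys :: "(nat \<times> 'a :: comm_ring_1) list"
  assumes "mset xs = mset ys"
  shows "similar_mat (jordan_matrix xs) (jordan_matrix ys)"
  using assms
proof (induction xs arbitrary: ys)
  case Nil
  then show ?case by (auto intro: similar_mat_refl[of _ 0])
next
  case (Cons x xs)
  have "x \<in> set ys" using Cons.prems by (metis list.set_intros(1) set_mset_mset)
  then obtain us vs where ys: "ys = us @ x # vs" by (meson split_list)
  have "mset xs = mset (us @ vs)" using Cons.prems ys by simp
  note IH = Cons.IH[OF this]
  obtain m a where x: "x = (m, a)" by force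
  let ?B = "jordan_block m a" and ?U = "jordan_matrix us" and ?V = "jordan_matrix vs"
  have "similar_mat (?B \<oplus>\<^sub>m jordan_matrix xs) (?B \<oplus>\<^sub>m jordan_matrix (us @ vs))"
    by (rule similar_mat_dsum[OF similar_mat_refl IH]) (rule jordan_block_carrier)
  also have "?B \<oplus>\<^sub>m jordan_matrix (us @ vs) = (?B \<oplus>\<^sub>m ?U) \<oplus>\<^sub>m ?V"
    by (simp add: jordan_matrix_append dsum_mat_assoc)
  finally have 1: "similar_mat (jordan_matrix (x # xs)) ((?B \<oplus>\<^sub>m ?U) \<oplus>\<^sub>m ?V)"
    by (simp add: x jordan_matrix_Cons_dsum)
  have 2: "similar_mat ((?B \<oplus>\<^sub>m ?U) \<oplus>\<^sub>m ?V) ((?U \<oplus>\<^sub>m ?B) \<oplus>\<^sub>m ?V)"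
    by (rule similar_mat_dsum[OF similar_mat_dsum_commute similar_mat_refl])
      (rule jordan_block_carrier jordan_matrix_carrier)+
  have 3: "(?U \<oplus>\<^sub>m ?B) \<oplus>\<^sub>m ?V = jordan_matrix ys"
    by (simp add: ys x jordan_matrix_append jordan_matrix_Cons_dsum dsum_mat_assoc)
  show ?case using similar_mat_trans[OF 1 2[unfolded 3]] .
qed

lemma complex_jordan_nf_exists:
  fixes A :: "complex mat"
  assumes "A \<in> carrier_mat n n"
  obtains xs where "jordan_nf A xs"
  using jordan_nf_exists[OF assms] char_poly_factorized[OF assms] by blast

subsection \<open>A parity argument in rings with a trace\<close>

context ring
begin

text \<open>In the corner ring of \<open>e\<close> the elements \<open>P\<close> and \<open>n\<close> act on the homology \<open>ker Q / im Q\<close>, where they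
  satisfy \<open>P n + n P = 1\<close> and \<open>P\<^sup>2 = 0\<close>, which forces even dimension. The idempotent \<open>p\<close> in the
  proof projects onto a complement of \<open>im Q\<close> in \<open>ker Q\<close>.\<close>

lemma corner_half_trace:
  fixes \<tau> :: "'a \<Rightarrow> complex"
  assumes [simp]: "e \<in> carrier R" "P \<in> carrier R" "Q \<in> carrier R" "n \<in> carrier R" "m \<in> carrier R" "G \<in> carrier R"
    and e: "e \<otimes> e = e" "e \<otimes> P = P" "P \<otimes> e = P" "e \<otimes> Q = Q" "Q \<otimes> e = Q" "e \<otimes> n = n" "n \<otimes> e = n" "e \<otimes> G = G" "G \<otimes> e = G"
    and PP: "P \<otimes> P = \<zero>" and QQ: "Q \<otimes> Q = \<zero>" and PQ: "P \<otimes> Q = Q \<otimes> P" and nQ: "n \<otimes> Q = Q \<otimes> n"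
    and QGQ: "Q \<otimes> G \<otimes> Q = Q"
    and unit: "e = (P \<otimes> n \<ominus> m \<otimes> Q) \<ominus> (Q \<otimes> m \<ominus> n \<otimes> P)"
    and add: "\<And>x y. x \<in> carrier R \<Longrightarrow> y \<in> carrier R \<Longrightarrow> \<tau> (x \<oplus> y) = \<tau> x + \<tau> y"
    and comm: "\<And>x y. x \<in> carrier R \<Longrightarrow> y \<in> carrier R \<Longrightarrow> \<tau> (x \<otimes> y) = \<tau> (y \<otimes> x)"
  obtains u where "u \<in> carrier R" "u \<otimes> u = u"
    "\<tau> e = 2 * \<tau> u + 2 * \<tau> (Q \<otimes> G)"
proof -
  \<comment> \<open>Read as maps, \<open>Q G\<close> is idempotent with range im Q, so
    \<open>a\<close> kills im Q while \<open>b\<close> projects onto ker Q. As im Q lies in ker Q,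
    the product \<open>a b\<close> is idempotent of rank dim (ker Q / im Q).\<close>
  define a where "a = e \<ominus> Q \<otimes> G"
  define b where "b = e \<ominus> G \<otimes> Q"
  define p where "p = a \<otimes> b"
  have [simp]: "a \<in> carrier R" "b \<in> carrier R" "p \<in> carrier R"
    unfolding a_def b_def p_def by auto
  have xa: "x \<otimes> a = x" if "x \<in> carrier R" "x \<otimes> e = x" "x \<otimes> Q = \<zero>" for x
  proof -
    have "x \<otimes> a = x \<otimes> e \<ominus> (x \<otimes> Q) \<otimes> G"
      unfolding a_def using that(1) assms(1-6) by algebra
    then show ?thesis using that by (simp add: a_minus_def)
  qed
  have b_left: "b \<otimes> y = y" if "y \<in> carrier R" "e \<otimes> y = y" "Q \<otimes> y = \<zero>" for y
  proof -
    have "b \<otimes> y = e \<otimes> y \<ominus> G \<otimes> (Q \<otimes> y)"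
      unfolding b_def using that(1) assms(1-6) by algebra
    then show ?thesis using that by (simp add: a_minus_def)
  qed
  have aQ: "a \<otimes> Q = \<zero>"
  proof -
    have "a \<otimes> Q = e \<otimes> Q \<ominus> Q \<otimes> G \<otimes> Q" unfolding a_def using assms(1-6) by algebra
    then show ?thesis using e QGQ by (simp add: a_minus_def r_neg)
  qed
  have Qb: "Q \<otimes> b = \<zero>"
  proof -
    have "Q \<otimes> b = Q \<otimes> e \<ominus> Q \<otimes> G \<otimes> Q" unfolding b_def using assms(1-6) by algebra
    then show ?thesis using e QGQ by (simp add: a_minus_def r_neg)
  qed
  have ae: "a \<otimes> e = a" "e \<otimes> b = b" "b \<otimes> e = b" "e \<otimes> a = a"
  proof -
    have "a \<otimes> e = e \<otimes> e \<ominus> Q \<otimes> (G \<otimes> e)" unfolding a_def using assms(1-6) by algebra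
    then show "a \<otimes> e = a" unfolding e a_def .
    have "e \<otimes> a = e \<otimes> e \<ominus> (e \<otimes> Q) \<otimes> G" unfolding a_def using assms(1-6) by algebra
    then show "e \<otimes> a = a" unfolding e a_def .
    have "b \<otimes> e = e \<otimes> e \<ominus> G \<otimes> (Q \<otimes> e)" unfolding b_def using assms(1-6) by algebra
    then show "b \<otimes> e = b" unfolding e b_def .
    have "e \<otimes> b = e \<otimes> e \<ominus> (e \<otimes> G) \<otimes> Q" unfolding b_def using assms(1-6) by algebra
    then show "e \<otimes> b = b" unfolding e b_def .
  qed
  have pe: "p \<otimes> e = p" "e \<otimes> p = p"
    unfolding p_def using ae by (auto simp: m_assoc) (simp flip: m_assoc)
  have pQ: "p \<otimes> Q = \<zero>"
    using b_left[of Q] e QQ aQ by (simp add: p_def m_assoc)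
  have Qp: "Q \<otimes> p = \<zero>"
    using xa[of Q] e QQ Qb by (simp add: p_def flip: m_assoc)
  have bb: "b \<otimes> b = b" using b_left[of b] ae Qb by simp
  have pb: "p \<otimes> b = p" by (simp add: p_def m_assoc bb)
  have xpy: "x \<otimes> p \<otimes> y = x \<otimes> y"
    if "x \<in> carrier R" "y \<in> carrier R" "x \<otimes> e = x" "x \<otimes> Q = \<zero>" "e \<otimes> y = y" "Q \<otimes> y = \<zero>" for x y
    using xa[of x] b_left[of y] that by (simp add: p_def m_assoc) (simp flip: m_assoc)
  have pp: "p \<otimes> p = p"
    using xa[of p] pe pQ pb by (simp add: p_def) (simp flip: m_assoc)
  have pPQ: "p \<otimes> P \<otimes> Q = \<zero>" using pQ by (simp add: m_assoc PQ) (simp flip: m_assoc)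
  have pnQ: "p \<otimes> n \<otimes> Q = \<zero>" using pQ by (simp add: m_assoc nQ) (simp flip: m_assoc)
  have QPp: "Q \<otimes> (P \<otimes> p) = \<zero>" using Qp by (simp flip: m_assoc PQ) (simp add: m_assoc)
  have Qnp: "Q \<otimes> (n \<otimes> p) = \<zero>" using Qp by (simp flip: m_assoc nQ) (simp add: m_assoc)
  define u where "u = p \<otimes> P \<otimes> n \<otimes> p"
  define w where "w = p \<otimes> n \<otimes> P \<otimes> p"
  have [simp]: "u \<in> carrier R" "w \<in> carrier R" unfolding u_def w_def by auto
  \<comment> \<open>This is \<open>unit\<close> multiplied by \<open>P\<close> from the left, where
    \<open>PP\<close> removes one term. Up to terms with \<open>Q\<close> it reads P n P = P, which
    is what makes \<open>u\<close> idempotent.\<close>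
  have PnP: "P \<otimes> n \<otimes> P = P \<oplus> P \<otimes> m \<otimes> Q \<oplus> P \<otimes> Q \<otimes> m"
  proof -
    have "P \<oplus> P \<otimes> m \<otimes> Q \<oplus> P \<otimes> Q \<otimes> m = P \<otimes> e \<oplus> P \<otimes> m \<otimes> Q \<oplus> P \<otimes> Q \<otimes> m"
      using e by simp
    also have "\<dots> = P \<otimes> P \<otimes> n \<oplus> P \<otimes> n \<otimes> P"
      by (subst unit) (use assms(1-6) in algebra)
    finally show ?thesis using PP by simp
  qed
  have uu: "u \<otimes> u = u"
  proof -
    have "u \<otimes> u = (p \<otimes> P \<otimes> n) \<otimes> (p \<otimes> p) \<otimes> (P \<otimes> n \<otimes> p)"
      unfolding u_def by (simp add: m_assoc)
    also have "\<dots> = (p \<otimes> P \<otimes> n) \<otimes> (P \<otimes> n \<otimes> p)"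
      unfolding pp
    proof (rule xpy)
      have "p \<otimes> P \<otimes> n \<otimes> Q = (p \<otimes> P \<otimes> Q) \<otimes> n" by (simp add: m_assoc nQ)
      then show "p \<otimes> P \<otimes> n \<otimes> Q = \<zero>" by (simp add: pPQ)
      have "Q \<otimes> (P \<otimes> n \<otimes> p) = P \<otimes> (Q \<otimes> (n \<otimes> p))"
        by (simp flip: m_assoc PQ)
      then show "Q \<otimes> (P \<otimes> n \<otimes> p) = \<zero>" by (simp add: Qnp)
      show "p \<otimes> P \<otimes> n \<otimes> e = p \<otimes> P \<otimes> n" by (simp add: m_assoc e)
      show "e \<otimes> (P \<otimes> n \<otimes> p) = P \<otimes> n \<otimes> p" by (simp add: e flip: m_assoc)
    qed auto
    also have "\<dots> = p \<otimes> (P \<otimes> n \<otimes> P) \<otimes> (n \<otimes> p)" by (simp add: m_assoc)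
    also have "\<dots> = p \<otimes> P \<otimes> n \<otimes> p \<oplus> p \<otimes> P \<otimes> m \<otimes> (Q \<otimes> (n \<otimes> p)) \<oplus> (p \<otimes> P \<otimes> Q) \<otimes> (m \<otimes> n \<otimes> p)"
      unfolding PnP using assms(1-6) \<open>p \<in> carrier R\<close> by algebra
    also have "\<dots> = u" by (simp add: pPQ Qnp u_def)
    finally show ?thesis .
  qed
  have puw: "p = u \<oplus> w"
  proof -
    have "p = p \<otimes> e \<otimes> p" using pe pp by simp
    also have "\<dots> = u \<ominus> p \<otimes> m \<otimes> (Q \<otimes> p) \<ominus> (p \<otimes> Q) \<otimes> (m \<otimes> p) \<oplus> w"
      unfolding u_def w_def by (subst unit) (use assms(1-6) \<open>p \<in> carrier R\<close> in algebra)
    also have "\<dots> = u \<oplus> w" by (simp add: Qp pQ a_minus_def)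
    finally show ?thesis .
  qed
  \<comment> \<open>\<open>u\<close> and \<open>w\<close> turn out to be the two products of the
    same two elements, hence have the same trace.\<close>
  have u: "u = (p \<otimes> P \<otimes> p) \<otimes> (p \<otimes> n \<otimes> p)"
  proof -
    have "(p \<otimes> P \<otimes> p) \<otimes> (p \<otimes> n \<otimes> p) = (p \<otimes> P) \<otimes> (p \<otimes> p) \<otimes> (n \<otimes> p)" by (simp add: m_assoc)
    also have "\<dots> = (p \<otimes> P) \<otimes> (n \<otimes> p)"
      unfolding pp by (rule xpy) (auto simp: pPQ Qnp m_assoc e, simp add: e flip: m_assoc)
    finally show ?thesis by (simp add: u_def m_assoc)
  qed
  have w: "w = (p \<otimes> n \<otimes> p) \<otimes> (p \<otimes> P \<otimes> p)"
  proof -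
    have "(p \<otimes> n \<otimes> p) \<otimes> (p \<otimes> P \<otimes> p) = (p \<otimes> n) \<otimes> (p \<otimes> p) \<otimes> (P \<otimes> p)" by (simp add: m_assoc)
    also have "\<dots> = (p \<otimes> n) \<otimes> (P \<otimes> p)"
      unfolding pp by (rule xpy) (auto simp: pnQ QPp m_assoc e, simp add: e flip: m_assoc)
    finally show ?thesis by (simp add: w_def m_assoc)
  qed
  \<comment> \<open>The order \<open>b a\<close> matters: its last term G Q Q G vanishes, whereas
    that of \<open>p = a b\<close> need not. Both orders have the same trace, so the trace of
    \<open>e\<close> is that of \<open>p\<close> plus twice that of \<open>Q G\<close>.\<close>
  have e_eq: "e = b \<otimes> a \<oplus> (G \<otimes> Q \<oplus> Q \<otimes> G)"
  proof -
    have "b \<otimes> a \<oplus> (G \<otimes> Q \<oplus> Q \<otimes> G) = e \<otimes> e \<ominus> e \<otimes> Q \<otimes> G \<ominus> G \<otimes> (Q \<otimes> e) \<oplus> G \<otimes> (Q \<otimes> Q) \<otimes> G \<oplus> (G \<otimes> Q \<oplus> Q \<otimes> G)"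
      unfolding a_def b_def using assms(1-6) by algebra
    also have "\<dots> = e" unfolding e QQ using assms(1-6) by algebra
    finally show ?thesis by simp
  qed
  show thesis
  proof (rule that[OF \<open>u \<in> carrier R\<close> uu])
    have "\<tau> e = \<tau> (b \<otimes> a) + (\<tau> (G \<otimes> Q) + \<tau> (Q \<otimes> G))"
      by (subst e_eq) (simp add: add)
    also have "\<tau> (b \<otimes> a) = \<tau> p" unfolding p_def by (rule comm) auto
    also have "\<tau> p = \<tau> u + \<tau> w" by (subst puw) (simp add: add)
    also have "\<tau> w = \<tau> u" unfolding u w by (rule comm) auto
    also have "\<tau> (G \<otimes> Q) = \<tau> (Q \<otimes> G)" by (rule comm) auto
    finally show "\<tau> e = 2 * \<tau> u + 2 * \<tau> (Q \<otimes> G)" by simp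
  qed
qed

text \<open>\<open>D\<close> stands for a power of \<open>T\<close>, and \<open>M'\<close>,
  \<open>N'\<close> carry the sign picked up by moving across it. \<open>S\<close> lifts the range
  of \<open>e\<close> through \<open>T D\<close>, so compressing the relations N N = 0 and T = M N -
  N M to e D _ S produces the identities that \<open>corner_half_trace\<close> asks for.\<close>

lemma commutator_corner_half_trace:
  fixes \<tau> :: "'a \<Rightarrow> complex"
  assumes [simp]: "T \<in> carrier R" "M \<in> carrier R" "N \<in> carrier R" "M' \<in> carrier R" "N' \<in> carrier R"
      "D \<in> carrier R" "S \<in> carrier R" "X \<in> carrier R"
    and regular: "\<And>x. x \<in> carrier R \<Longrightarrow> \<exists>y \<in> carrier R. x \<otimes> y \<otimes> x = x"
    and T: "T = M \<otimes> N \<ominus> N \<otimes> M" and T': "T = M' \<otimes> N' \<ominus> N' \<otimes> M'"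
    and NN: "N \<otimes> N = \<zero>" and M'M': "M' \<otimes> M' = \<zero>" and N'N': "N' \<otimes> N' = \<zero>"
    and DM: "D \<otimes> M = M' \<otimes> D" and DN: "D \<otimes> N = N' \<otimes> D"
    and TM: "T \<otimes> M' = \<ominus> (M' \<otimes> T)" and TN: "T \<otimes> N' = \<ominus> (N' \<otimes> T)"
    and DT: "D \<otimes> T = T \<otimes> D"
    and e: "e = T \<otimes> D \<otimes> S" and Te: "T \<otimes> e = \<zero>" and Se: "S \<otimes> e = S" and SDS: "S \<otimes> D \<otimes> S = \<zero>"
    and D: "D = e \<otimes> D \<oplus> X \<otimes> T \<otimes> D"
    and add: "\<And>x y. x \<in> carrier R \<Longrightarrow> y \<in> carrier R \<Longrightarrow> \<tau> (x \<oplus> y) = \<tau> x + \<tau> y"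
    and comm: "\<And>x y. x \<in> carrier R \<Longrightarrow> y \<in> carrier R \<Longrightarrow> \<tau> (x \<otimes> y) = \<tau> (y \<otimes> x)"
  obtains u v where "u \<in> carrier R" "u \<otimes> u = u" "v \<in> carrier R" "v \<otimes> v = v"
    "\<tau> e = 2 * \<tau> u + 2 * \<tau> v"
proof -
  have [simp]: "e \<in> carrier R" unfolding e by simp
  have ee: "e \<otimes> e = e" unfolding e using Se[unfolded e] by (simp add: m_assoc)
  have eDS: "e \<otimes> D \<otimes> S = \<zero>" unfolding e using SDS by (simp add: m_assoc)
  \<comment> \<open>Read on vectors, the hypothesis on \<open>D\<close> says that every element of
    im D killed by \<open>T\<close> lies in the range of \<open>e\<close>.\<close>
  have DV: "D \<otimes> V = e \<otimes> (D \<otimes> V)" if "V \<in> carrier R" "T \<otimes> (D \<otimes> V) = \<zero>" for V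
  proof -
    have "D \<otimes> V = (e \<otimes> D \<oplus> X \<otimes> T \<otimes> D) \<otimes> V" using D by simp
    also have "\<dots> = e \<otimes> (D \<otimes> V) \<oplus> X \<otimes> (T \<otimes> (D \<otimes> V))"
      using that(1) assms(1-8) \<open>e \<in> carrier R\<close> by algebra
    finally show ?thesis using that by simp
  qed
  \<comment> \<open>\<open>B' e\<close> equals - D (T B S), so its range is in im D; anticommuting
    \<open>T\<close> past \<open>B'\<close> shows that it is also in ker T. Hence \<open>e\<close>
    fixes it, and \<open>M'\<close>, \<open>N'\<close> restrict to the range of
    \<open>e\<close>.\<close>
  have inv: "e \<otimes> B' \<otimes> e = B' \<otimes> e"
    if [simp]: "B \<in> carrier R" "B' \<in> carrier R" and DB: "D \<otimes> B = B' \<otimes> D" and TB: "T \<otimes> B' = \<ominus> (B' \<otimes> T)" for B B'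
  proof -
    have "D \<otimes> (T \<otimes> B \<otimes> S) = T \<otimes> (D \<otimes> B) \<otimes> S"
      using DT by (simp add: m_assoc flip: m_assoc[of D T])
    also have "\<dots> = (T \<otimes> B') \<otimes> D \<otimes> S" by (simp add: DB m_assoc)
    also have "\<dots> = \<ominus> (B' \<otimes> e)" by (simp add: TB e l_minus m_assoc)
    finally have *: "D \<otimes> (T \<otimes> B \<otimes> S) = \<ominus> (B' \<otimes> e)" .
    have "T \<otimes> (B' \<otimes> e) = T \<otimes> B' \<otimes> e" by (simp add: m_assoc)
    also have "\<dots> = \<ominus> (B' \<otimes> (T \<otimes> e))" by (simp add: TB l_minus m_assoc)
    finally have "T \<otimes> (B' \<otimes> e) = \<zero>" by (simp add: Te)
    then have "T \<otimes> (D \<otimes> (T \<otimes> B \<otimes> S)) = \<zero>" unfolding * by (simp add: r_minus)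
    from DV[OF _ this] have "\<ominus> (B' \<otimes> e) = e \<otimes> \<ominus> (B' \<otimes> e)" unfolding * by simp
    also have "\<dots> = \<ominus> (e \<otimes> B' \<otimes> e)" by (simp add: r_minus m_assoc)
    finally show ?thesis by (metis minus_minus m_closed that(2) \<open>e \<in> carrier R\<close>)
  qed
  \<comment> \<open>T D B S = - B' e is cancelled by T D S B' e = B' e. So adding D S B' e brings D
    B S into ker T, where \<open>e\<close> acts as the identity on im D, and \<open>eDS\<close>
    removes the correction from the right-hand side.\<close>
  have split: "D \<otimes> B \<otimes> S = e \<otimes> D \<otimes> B \<otimes> S \<ominus> D \<otimes> S \<otimes> B' \<otimes> e"
    if [simp]: "B \<in> carrier R" "B' \<in> carrier R" and DB: "D \<otimes> B = B' \<otimes> D" and TB: "T \<otimes> B' = \<ominus> (B' \<otimes> T)" for B B'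
  proof -
    have "T \<otimes> (D \<otimes> (B \<otimes> S \<oplus> S \<otimes> B' \<otimes> e)) = T \<otimes> (D \<otimes> B) \<otimes> S \<oplus> T \<otimes> D \<otimes> S \<otimes> (B' \<otimes> e)"
      using that(1,2) assms(1-8) \<open>e \<in> carrier R\<close> by algebra
    also have "\<dots> = (T \<otimes> B') \<otimes> (D \<otimes> S) \<oplus> e \<otimes> (B' \<otimes> e)" by (simp add: DB m_assoc e)
    also have "\<dots> = \<ominus> (B' \<otimes> e) \<oplus> B' \<otimes> e"
      using inv[OF that] by (simp add: TB l_minus m_assoc e)
    also have "\<dots> = \<zero>" by (simp add: l_neg)
    finally have "D \<otimes> (B \<otimes> S \<oplus> S \<otimes> B' \<otimes> e) = e \<otimes> (D \<otimes> (B \<otimes> S \<oplus> S \<otimes> B' \<otimes> e))"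
      by (intro DV) auto
    also have "\<dots> = e \<otimes> D \<otimes> B \<otimes> S \<oplus> (e \<otimes> D \<otimes> S) \<otimes> (B' \<otimes> e)"
      using that(1,2) assms(1-8) \<open>e \<in> carrier R\<close> by algebra
    also have "\<dots> = e \<otimes> D \<otimes> B \<otimes> S" by (simp add: eDS)
    finally have "e \<otimes> D \<otimes> B \<otimes> S \<ominus> D \<otimes> S \<otimes> B' \<otimes> e = D \<otimes> (B \<otimes> S \<oplus> S \<otimes> B' \<otimes> e) \<ominus> D \<otimes> S \<otimes> B' \<otimes> e" by simp
    also have "\<dots> = D \<otimes> B \<otimes> S" using that(1,2) assms(1-8) \<open>e \<in> carrier R\<close> by algebra
    finally show ?thesis by simp
  qed
  \<comment> \<open>The compression of \<open>B\<close> to e D B S obeys a twisted product rule,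
    with \<open>B' e\<close> and \<open>C' e\<close> as the outer actions and a minus sign due to
    anticommutation with \<open>T\<close>. Applied to N N = 0 it gives \<open>nQ\<close>; applied to
    M N - N M it gives \<open>unit\<close>.\<close>
  have prod: "e \<otimes> D \<otimes> (B \<otimes> C) \<otimes> S = (B' \<otimes> e) \<otimes> (e \<otimes> D \<otimes> C \<otimes> S) \<ominus> (e \<otimes> D \<otimes> B \<otimes> S) \<otimes> (C' \<otimes> e)"
    if B [simp]: "B \<in> carrier R" "B' \<in> carrier R" and DB: "D \<otimes> B = B' \<otimes> D" "T \<otimes> B' = \<ominus> (B' \<otimes> T)"
      and C [simp]: "C \<in> carrier R" "C' \<in> carrier R" and DC: "D \<otimes> C = C' \<otimes> D" "T \<otimes> C' = \<ominus> (C' \<otimes> T)" for B B' C C'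
  proof -
    have "e \<otimes> D \<otimes> (B \<otimes> C) \<otimes> S = e \<otimes> (D \<otimes> B) \<otimes> C \<otimes> S" by (simp add: m_assoc)
    also have "\<dots> = e \<otimes> B' \<otimes> (D \<otimes> C \<otimes> S)" by (simp add: DB m_assoc)
    also have "\<dots> = e \<otimes> B' \<otimes> (e \<otimes> D \<otimes> C \<otimes> S \<ominus> D \<otimes> S \<otimes> C' \<otimes> e)"
      by (subst split[OF C DC]) simp
    also have "\<dots> = (e \<otimes> B' \<otimes> e) \<otimes> D \<otimes> C \<otimes> S \<ominus> e \<otimes> (B' \<otimes> D) \<otimes> S \<otimes> C' \<otimes> e"
      using B C assms(1-8) \<open>e \<in> carrier R\<close> by algebra
    also have "\<dots> = (B' \<otimes> (e \<otimes> e)) \<otimes> D \<otimes> C \<otimes> S \<ominus> e \<otimes> (D \<otimes> B) \<otimes> S \<otimes> C' \<otimes> e"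
      by (simp add: inv[OF B DB] DB ee)
    finally show ?thesis by (simp add: m_assoc)
  qed
  define P where "P = M' \<otimes> e"
  define Q where "Q = N' \<otimes> e"
  define n where "n = e \<otimes> D \<otimes> N \<otimes> S"
  define m where "m = e \<otimes> D \<otimes> M \<otimes> S"
  have [simp]: "P \<in> carrier R" "Q \<in> carrier R" "n \<in> carrier R" "m \<in> carrier R"
    unfolding P_def Q_def n_def m_def by auto
  have eP: "e \<otimes> P = P" "P \<otimes> e = P"
    unfolding P_def using inv[OF _ _ DM TM] ee by (auto simp: m_assoc)
  have eQ: "e \<otimes> Q = Q" "Q \<otimes> e = Q"
    unfolding Q_def using inv[OF _ _ DN TN] ee by (auto simp: m_assoc)
  have en: "e \<otimes> n = n" "n \<otimes> e = n"
  proof -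
    have "e \<otimes> n = (e \<otimes> e) \<otimes> D \<otimes> N \<otimes> S" by (simp add: n_def m_assoc)
    then show "e \<otimes> n = n" by (simp add: ee n_def)
    show "n \<otimes> e = n" using Se by (simp add: n_def m_assoc)
  qed
  have MeQ: "P \<otimes> x = M' \<otimes> x" "Q \<otimes> x = N' \<otimes> x" if "x \<in> carrier R" "e \<otimes> x = x" for x
    using that by (auto simp: P_def Q_def m_assoc)
  have PP: "P \<otimes> P = \<zero>"
    using MeQ(1)[of P] eP M'M' by (simp add: P_def flip: m_assoc)
  have QQ: "Q \<otimes> Q = \<zero>"
    using MeQ(2)[of Q] eQ N'N' by (simp add: Q_def flip: m_assoc)
  have "P \<otimes> Q \<ominus> Q \<otimes> P = M' \<otimes> N' \<otimes> e \<ominus> N' \<otimes> M' \<otimes> e"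
    using MeQ(1)[of Q] MeQ(2)[of P] eP eQ by (simp add: P_def Q_def m_assoc)
  also have "\<dots> = (M' \<otimes> N' \<ominus> N' \<otimes> M') \<otimes> e"
    using assms(1-8) \<open>e \<in> carrier R\<close> by algebra
  also have "\<dots> = \<zero>" using Te T' by simp
  finally have PQ: "P \<otimes> Q = Q \<otimes> P" by simp
  have "Q \<otimes> n \<ominus> n \<otimes> Q = e \<otimes> D \<otimes> (N \<otimes> N) \<otimes> S"
    using prod[OF _ _ DN TN _ _ DN TN] by (simp add: Q_def n_def)
  also have "\<dots> = \<zero>" by (simp add: NN)
  finally have nQ: "n \<otimes> Q = Q \<otimes> n" by simp
  have "e = e \<otimes> e" by (simp add: ee)
  also have "\<dots> = e \<otimes> (D \<otimes> T) \<otimes> S" by (simp add: e DT m_assoc)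
  also have "\<dots> = e \<otimes> D \<otimes> (M \<otimes> N) \<otimes> S \<ominus> e \<otimes> D \<otimes> (N \<otimes> M) \<otimes> S"
    unfolding T using assms(1-8) \<open>e \<in> carrier R\<close> by algebra
  also have "\<dots> = (P \<otimes> n \<ominus> m \<otimes> Q) \<ominus> (Q \<otimes> m \<ominus> n \<otimes> P)"
    using prod[OF _ _ DN TN _ _ DM TM] prod[OF _ _ DM TM _ _ DN TN]
    by (simp add: P_def Q_def n_def m_def)
  finally have unit: "e = (P \<otimes> n \<ominus> m \<otimes> Q) \<ominus> (Q \<otimes> m \<ominus> n \<otimes> P)" .
  obtain G0 where [simp]: "G0 \<in> carrier R" and G0: "Q \<otimes> G0 \<otimes> Q = Q" using regular[of Q] by auto
  \<comment> \<open>A generalised inverse of \<open>Q\<close> in the whole ring, cut down to the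
    corner; it stays one because \<open>Q\<close> already lies in the corner.\<close>
  define G where "G = e \<otimes> G0 \<otimes> e"
  have [simp]: "G \<in> carrier R" by (simp add: G_def)
  have eG: "e \<otimes> G = G" "G \<otimes> e = G" 
    using ee by (simp_all add: G_def m_assoc flip: m_assoc[of e e])
  have "Q \<otimes> G \<otimes> Q = (Q \<otimes> e) \<otimes> G0 \<otimes> (e \<otimes> Q)" by (simp add: G_def m_assoc)
  then have QGQ: "Q \<otimes> G \<otimes> Q = Q" by (simp add: eQ G0)
  have idem: "(Q \<otimes> G) \<otimes> (Q \<otimes> G) = Q \<otimes> G" using QGQ by (simp flip: m_assoc)
  show thesis
    by (rule corner_half_trace[OF \<open>e \<in> carrier R\<close> \<open>P \<in> carrier R\<close> \<open>Q \<in> carrier R\<close> \<open>n \<in> carrier R\<close>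
      \<open>m \<in> carrier R\<close> \<open>G \<in> carrier R\<close> ee eP eQ en eG PP QQ PQ nQ QGQ unit, of \<tau>])
      (use that[of _ "Q \<otimes> G"] idem add comm in auto)
qed

end

subsection \<open>Traces and generalised inverses of matrices\<close>

definition mat_trace :: "'a :: semiring_1 mat \<Rightarrow> 'a" where
  "mat_trace A = (\<Sum>i<dim_row A. A $$ (i,i))"

lemma mat_trace_add:
  "A \<in> carrier_mat n n \<Longrightarrow> B \<in> carrier_mat n n \<Longrightarrow> mat_trace (A + B) = mat_trace A + mat_trace B"
  unfolding mat_trace_def by (auto simp: sum.distrib)

lemma mat_trace_mult_commute:
  fixes A :: "'a :: comm_semiring_1 mat"
  assumes "A \<in> carrier_mat n n" "B \<in> carrier_mat n n"
  shows "mat_trace (A * B) = mat_trace (B * A)"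
proof -
  have "mat_trace (A * B) = (\<Sum>i<n. \<Sum>j<n. A $$ (i,j) * B $$ (j,i))"
    unfolding mat_trace_def using assms by (auto simp: scalar_prod_def lessThan_atLeast0)
  also have "\<dots> = (\<Sum>j<n. \<Sum>i<n. B $$ (j,i) * A $$ (i,j))"
    by (subst sum.swap) (simp add: mult.commute)
  also have "\<dots> = mat_trace (B * A)"
    unfolding mat_trace_def using assms by (auto simp: scalar_prod_def lessThan_atLeast0)
  finally show ?thesis .
qed

lemma mat_trace_similar:
  fixes A :: "'a :: comm_semiring_1 mat"
  assumes "similar_mat A B"
  shows "mat_trace A = mat_trace B"
proof -
  obtain n P Q where carrier: "A \<in> carrier_mat n n" "B \<in> carrier_mat n n" "P \<in> carrier_mat n n" "Q \<in> carrier_mat n n"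
    and QP: "Q * P = 1\<^sub>m n" and A: "A = P * B * Q"
    using similar_matD[OF assms] by (metis insert_subset)
  have "mat_trace A = mat_trace (Q * (P * B))"
    unfolding A using carrier by (intro mat_trace_mult_commute) auto
  also have "Q * (P * B) = Q * P * B" using carrier by (simp add: assoc_mult_mat)
  also have "\<dots> = B" using carrier QP by simp
  finally show ?thesis .
qed

lemma mat_trace_dsum:
  assumes "A \<in> carrier_mat m m" "B \<in> carrier_mat n n"
  shows "mat_trace (A \<oplus>\<^sub>m B) = mat_trace A + mat_trace B"
proof -
  have *: "{..<m + n} = {..<m} \<union> {m..<m + n}" by auto
  have "mat_trace (A \<oplus>\<^sub>m B) = (\<Sum>i<m. (A \<oplus>\<^sub>m B) $$ (i,i)) + (\<Sum>i = m..<m + n. (A \<oplus>\<^sub>m B) $$ (i,i))"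
    unfolding mat_trace_def using assms by (auto simp: * sum.union_disjoint ivl_disj_int)
  also have "(\<Sum>i = m..<m + n. (A \<oplus>\<^sub>m B) $$ (i,i)) = (\<Sum>i<n. (A \<oplus>\<^sub>m B) $$ (m + i, m + i))"
    by (rule sum.reindex_bij_witness[of _ "\<lambda>i. m + i" "\<lambda>i. i - m"]) auto
  finally show ?thesis
    using assms unfolding mat_trace_def dsum_mat_def by simp
qed

text \<open>The Jordan form is again idempotent and is upper triangular, so each diagonal entry is
  an idempotent scalar, 0 or 1. This integrality is what turns a half-trace identity into a parity
  statement.\<close>

lemma mat_trace_idempotent:
  fixes A :: "complex mat"
  assumes A: "A \<in> carrier_mat n n" and idem: "A * A = A"
  shows "mat_trace A \<in> \<nat>"
proof -
  obtain xs where "jordan_nf A xs" using complex_jordan_nf_exists[OF A] .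
  then have sim: "similar_mat A (jordan_matrix xs)" unfolding jordan_nf_def by simp
  define J where "J = jordan_matrix xs"
  obtain P Q where PQ: "similar_mat_wit J A P Q"
    using similar_mat_sym[OF sim] unfolding similar_mat_def J_def by auto
  have J: "J \<in> carrier_mat n n" using similar_matD[OF sim] A unfolding J_def by auto
  have JJ: "J * J = J"
    using similar_mat_wit_pow_id[OF PQ, of 2] similar_mat_wit_pow_id[OF PQ, of 1] A J idem
    by (simp add: numeral_2_eq_2)
  have "J $$ (i,i) \<in> \<nat>" if i: "i < n" for i
  proof -
    have low: "J $$ (k,j) = 0" if "j < k" "k < n" for j k
      using jordan_matrix_upper_triangular[of k xs j] that J unfolding J_def by auto
    have "J $$ (i,i) = (\<Sum>k<n. J $$ (i,k) * J $$ (k,i))"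
      using arg_cong[OF JJ, of "\<lambda>X. X $$ (i,i)"] J i by (simp add: scalar_prod_def lessThan_atLeast0)
    also have "\<dots> = (\<Sum>k<n. if k = i then J $$ (i,i) * J $$ (i,i) else 0)"
      by (intro sum.cong) (use low i in \<open>auto simp: neq_iff\<close>)
    also have "\<dots> = J $$ (i,i) * J $$ (i,i)" using i by simp
    finally have "J $$ (i,i) = 0 \<or> J $$ (i,i) = 1" by simp
    then show ?thesis by auto
  qed
  then have "(\<Sum>i<k. J $$ (i,i)) \<in> \<nat>" if "k \<le> n" for k
    using that by (induction k) auto
  then have "mat_trace J \<in> \<nat>" unfolding mat_trace_def using J by auto
  then show ?thesis using mat_trace_similar[OF sim] J_def by simp
qed

text \<open>Encodes a partial map \<open>f\<close> of the index set with domain \<open>P\<close>.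
  Powers of a nilpotent Jordan block and their partial inverses have this form, and multiplying them
  amounts to composing partial maps.\<close>

definition row_select_mat :: "nat \<Rightarrow> (nat \<Rightarrow> bool) \<Rightarrow> (nat \<Rightarrow> nat) \<Rightarrow> 'a :: semiring_1 mat" where
  "row_select_mat m P f = mat m m (\<lambda>(i,j). if P i \<and> j = f i then 1 else 0)"

lemma row_select_mat_carrier [simp]: "row_select_mat m P f \<in> carrier_mat m m"
  unfolding row_select_mat_def by simp

lemma row_select_mat_mult:
  assumes B: "B \<in> carrier_mat m m" and f: "\<And>i. i < m \<Longrightarrow> P i \<Longrightarrow> f i < m"
  shows "row_select_mat m P f * B = mat m m (\<lambda>(i,j). if P i then B $$ (f i, j) else 0)"
proof (rule eq_matI)
  fix i j assume ij: "i < dim_row (mat m m (\<lambda>(i,j). if P i then B $$ (f i, j) else 0))"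
    "j < dim_col (mat m m (\<lambda>(i,j). if P i then B $$ (f i, j) else 0))"
  then have "(row_select_mat m P f * B) $$ (i,j) = (\<Sum>k<m. (if P i \<and> k = f i then 1 else 0) * B $$ (k,j))"
    unfolding row_select_mat_def using B by (simp add: scalar_prod_def lessThan_atLeast0)
  also have "\<dots> = (\<Sum>k<m. if k = f i then (if P i then B $$ (k,j) else 0) else 0)"
    by (intro sum.cong) auto
  also have "\<dots> = (if P i then B $$ (f i, j) else 0)"
    using f[of i] ij by (auto simp: sum.delta)
  finally show "(row_select_mat m P f * B) $$ (i,j) = mat m m (\<lambda>(i,j). if P i then B $$ (f i, j) else 0) $$ (i,j)"
    using ij by simp
qed (use B in \<open>auto simp: row_select_mat_def\<close>)

lemma row_select_mat_mult_row_select: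
  assumes "\<And>i. i < m \<Longrightarrow> P i \<Longrightarrow> f i < m"
  shows "row_select_mat m P f * row_select_mat m P' f' = row_select_mat m (\<lambda>i. P i \<and> P' (f i)) (\<lambda>i. f' (f i))"
  using assms by (subst row_select_mat_mult) (auto simp: row_select_mat_def intro!: eq_matI)

lemma jordan_block_zero_pow_row_select:
  "jordan_block m (0 :: 'a :: field) ^\<^sub>m k = row_select_mat m (\<lambda>i. i + k < m) (\<lambda>i. i + k)"
  unfolding jordan_block_zero_pow row_select_mat_def by (auto intro!: eq_matI)

lemma jordan_block_inverse:
  fixes a :: "'a :: field"
  assumes "a \<noteq> 0"
  obtains B where "B \<in> carrier_mat m m" "jordan_block m a * B = 1\<^sub>m m" "B * jordan_block m a = 1\<^sub>m m"
proof -
  have "det (jordan_block m a) = prod_list (diag_mat (jordan_block m a))"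
    by (rule det_upper_triangular) auto
  also have "diag_mat (jordan_block m a) = replicate m a"
    using diag_jordan_block_pow[of m a 1] by simp
  finally have "det (jordan_block m a) \<noteq> 0" using assms by simp
  from det_non_zero_imp_unit[OF jordan_block_carrier this]
  show thesis using that unfolding Units_def by (auto simp: ring_mat_simps)
qed

lemma jordan_block_regular:
  fixes a :: "'a :: field"
  shows "\<exists>G \<in> carrier_mat m m. jordan_block m a * G * jordan_block m a = jordan_block m a"
proof (cases "a = 0")
  case True
  have J: "jordan_block m (0 :: 'a) = row_select_mat m (\<lambda>i. i + 1 < m) (\<lambda>i. i + 1)"
    using jordan_block_zero_pow_row_select[of m 1, where 'a = 'a] by simp
  \<comment> \<open>The transposed shift is a generalised inverse of the shift.\<close>
  show ?thesis
    unfolding True J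
    by (rule bexI[of _ "row_select_mat m (\<lambda>i. 0 < i) (\<lambda>i. i - 1)"])
      (auto simp: row_select_mat_mult_row_select cong: conj_cong)
next
  case False
  then obtain B where "B \<in> carrier_mat m m" "jordan_block m a * B = 1\<^sub>m m"
    using jordan_block_inverse by blast
  then show ?thesis by (intro bexI[of _ B]) auto
qed

lemma jordan_matrix_regular:
  fixes xs :: "(nat \<times> 'a :: field) list"
  defines "n \<equiv> sum_list (map fst xs)"
  shows "\<exists>G \<in> carrier_mat n n. jordan_matrix xs * G * jordan_matrix xs = jordan_matrix xs"
  unfolding n_def
proof (induction xs)
  case Nil
  then show ?case by (intro bexI[of _ "0\<^sub>m 0 0"]) auto
next
  case (Cons x xs)
  obtain m a where x: "x = (m, a)" by force
  let ?n = "sum_list (map fst xs)" and ?B = "jordan_block m a" and ?J = "jordan_matrix xs"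
  obtain G where G: "G \<in> carrier_mat m m" "?B * G * ?B = ?B" using jordan_block_regular by blast
  obtain H where H: "H \<in> carrier_mat ?n ?n" "?J * H * ?J = ?J" using Cons by blast
  have "(?B \<oplus>\<^sub>m ?J) * (G \<oplus>\<^sub>m H) = (?B * G) \<oplus>\<^sub>m (?J * H)"
    using G H by (intro dsum_mat_mult) auto
  also have "\<dots> * (?B \<oplus>\<^sub>m ?J) = (?B * G * ?B) \<oplus>\<^sub>m (?J * H * ?J)"
    by (intro dsum_mat_mult[of _ m _ _ ?n]) (use G H in auto)
  finally show ?case using G H
    by (intro bexI[of _ "G \<oplus>\<^sub>m H"]) (auto simp: x jordan_matrix_Cons_dsum)
qed

text \<open>A generalised inverse is assembled block by block in Jordan form and conjugated back. It
  provides the element \<open>G\<close> of the parity argument.\<close>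

lemma complex_mat_regular:
  fixes A :: "complex mat"
  assumes A: "A \<in> carrier_mat n n"
  shows "\<exists>G \<in> carrier_mat n n. A * G * A = A"
proof -
  obtain xs where "jordan_nf A xs" using complex_jordan_nf_exists[OF A] .
  then have sim: "similar_mat A (jordan_matrix xs)" unfolding jordan_nf_def by simp
  define J where "J = jordan_matrix xs"
  obtain P Q where "similar_mat_wit A J P Q"
    using sim unfolding similar_mat_def J_def by auto
  note PQ = similar_mat_witD2[OF A this]
  have n: "n = sum_list (map fst xs)" using PQ unfolding J_def by auto
  obtain G where G: "G \<in> carrier_mat n n" "J * G * J = J"
    using jordan_matrix_regular[of xs] unfolding n J_def by blast
  have "A * (P * G * Q) * A = P * (J * (Q * P) * G * (Q * P) * J) * Q"
    unfolding PQ(3) using PQ(4-7) G(1) by (simp add: assoc_mult_mat[of _ n n _ n _ n])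
  also have "\<dots> = A" using PQ G by simp
  finally show ?thesis using PQ G by (intro bexI[of _ "P * G * Q"]) auto
qed

subsection \<open>Parity of the number of large nilpotent blocks\<close>

definition square_zero_commutator :: "nat \<Rightarrow> 'a :: comm_ring_1 mat \<Rightarrow> bool" where
  "square_zero_commutator n T \<longleftrightarrow> (\<exists>M N. M \<in> carrier_mat n n \<and> N \<in> carrier_mat n n \<and>
     M * M = 0\<^sub>m n n \<and> N * N = 0\<^sub>m n n \<and> T = M * N - N * M)"

lemma square_zero_commutator_similar:
  assumes sim: "similar_mat A B" and B: "square_zero_commutator n B"
  shows "square_zero_commutator n A"
proof -
  obtain M N where M: "M \<in> carrier_mat n n" "M * M = 0\<^sub>m n n"
    and N: "N \<in> carrier_mat n n" "N * N = 0\<^sub>m n n" and eq: "B = M * N - N * M"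
    using B unfolding square_zero_commutator_def by blast
  have Bc: "B \<in> carrier_mat n n" unfolding eq using M N by (intro minus_carrier_mat) auto
  obtain m P Q where "{A, B, P, Q} \<subseteq> carrier_mat m m" and QP: "Q * P = 1\<^sub>m m" and A: "A = P * B * Q"
    using similar_matD[OF sim] by blast
  moreover from this Bc have "m = n" by auto
  ultimately have P: "P \<in> carrier_mat n n" and Q: "Q \<in> carrier_mat n n" and QP: "Q * P = 1\<^sub>m n"
    by auto
  have conj: "(P * X * Q) * (P * Y * Q) = P * (X * Y) * Q"
    if X: "X \<in> carrier_mat n n" and Y: "Y \<in> carrier_mat n n" for X Y
  proof -
    have "(P * X * Q) * (P * Y * Q) = P * X * (Q * P) * Y * Q"
      using P Q X Y by (simp add: assoc_mult_mat[of _ n n _ n _ n])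
    then show ?thesis using P Q X Y by (simp add: QP assoc_mult_mat[of _ n n _ n _ n])
  qed
  have "A = P * (M * N) * Q - P * (N * M) * Q"
    unfolding A eq using M N P Q
    by (simp add: mult_minus_distrib_mat[of _ n n _ n] minus_mult_distrib_mat[of _ n n _ _ n])
  note A' = this
  show ?thesis
    unfolding square_zero_commutator_def
    by (rule exI[of _ "P * M * Q"], rule exI[of _ "P * N * Q"])
      (use A' M N P Q in \<open>simp add: conj mult_carrier_mat[of _ n n _ n] del: assoc_mult_mat\<close>)
qed

lemma square_zero_commutator_dsum:
  assumes A: "square_zero_commutator m A" and B: "square_zero_commutator n B"
  shows "square_zero_commutator (m + n) (A \<oplus>\<^sub>m B)"
proof -
  obtain M N where M: "M \<in> carrier_mat m m" "M * M = 0\<^sub>m m m"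
    and N: "N \<in> carrier_mat m m" "N * N = 0\<^sub>m m m" and A: "A = M * N - N * M"
    using A unfolding square_zero_commutator_def by blast
  obtain K L where K: "K \<in> carrier_mat n n" "K * K = 0\<^sub>m n n"
    and L: "L \<in> carrier_mat n n" "L * L = 0\<^sub>m n n" and B: "B = K * L - L * K"
    using B unfolding square_zero_commutator_def by blast
  show ?thesis
    unfolding square_zero_commutator_def A B
    by (rule exI[of _ "M \<oplus>\<^sub>m K"], rule exI[of _ "N \<oplus>\<^sub>m L"])
      (use M N K L in \<open>simp add: dsum_mat_mult[of _ m _ _ n] dsum_mat_minus[of _ m _ _ n] dsum_mat_zero\<close>)
qed

text \<open>Because the squares vanish, each product collapses to a single word, M N M or N M N,
  with opposite signs on the two sides.\<close>

lemma commutator_anticommutes: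
  fixes M N :: "'a :: comm_ring_1 mat"
  assumes M: "M \<in> carrier_mat n n" "M * M = 0\<^sub>m n n" and N: "N \<in> carrier_mat n n" "N * N = 0\<^sub>m n n"
  shows "(M * N - N * M) * M = - (M * (M * N - N * M))" "(M * N - N * M) * N = - (N * (M * N - N * M))"
proof -
  have "(M * N - N * M) * M = M * N * M - N * (M * M)"
    using M(1) N(1) by (simp add: minus_mult_distrib_mat[of _ n n _ _ n] assoc_mult_mat[of _ n n _ n _ n])
  also have "\<dots> = - (M * M * N - M * N * M)"
    using M N by (intro eq_matI) auto
  also have "M * M * N - M * N * M = M * (M * N - N * M)"
    using M(1) N(1) by (simp add: mult_minus_distrib_mat[of _ n n _ n] assoc_mult_mat[of _ n n _ n _ n])
  finally show "(M * N - N * M) * M = - (M * (M * N - N * M))" .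
  have "(M * N - N * M) * N = M * (N * N) - N * M * N"
    using M(1) N(1) by (simp add: minus_mult_distrib_mat[of _ n n _ _ n] assoc_mult_mat[of _ n n _ n _ n])
  also have "\<dots> = - (N * M * N - N * N * M)"
    using M N by (intro eq_matI) auto
  also have "N * M * N - N * N * M = N * (M * N - N * M)"
    using M(1) N(1) by (simp add: mult_minus_distrib_mat[of _ n n _ n] assoc_mult_mat[of _ n n _ n _ n])
  finally show "(M * N - N * M) * N = - (N * (M * N - N * M))" .
qed

lemma pow_mat_commute:
  fixes A :: "'a :: semiring_1 mat"
  assumes "A \<in> carrier_mat n n"
  shows "A ^\<^sub>m k * A = A * A ^\<^sub>m k"
proof (induction k)
  case 0
  then show ?case using assms by simp
next
  case (Suc k)
  then show ?case using assms by (simp add: assoc_mult_mat[of _ n n _ n _ n])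
qed

lemma uminus_mult_mat:
  fixes A B :: "'a :: comm_ring_1 mat"
  assumes "A \<in> carrier_mat n n" "B \<in> carrier_mat n n"
  shows "- A * B = - (A * B)" "A * - B = - (A * B)"
  using assms by (auto intro!: eq_matI)

lemma anticommute_pow:
  fixes T B :: "'a :: comm_ring_1 mat"
  assumes T: "T \<in> carrier_mat n n" and B: "B \<in> carrier_mat n n" and TB: "T * B = - (B * T)"
  shows "T ^\<^sub>m r * B = (if even r then B else - B) * T ^\<^sub>m r"
proof (induction r)
  case 0
  then show ?case using T B by simp
next
  case (Suc r)
  define C where "C = (if even r then B else - B)"
  have [simp]: "T ^\<^sub>m r \<in> carrier_mat n n" "C \<in> carrier_mat n n" using T B by (auto simp: C_def)
  have "T ^\<^sub>m Suc r * B = T ^\<^sub>m r * (T * B)" using T B by (simp add: assoc_mult_mat[of _ n n _ n _ n])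
  also have "\<dots> = - (T ^\<^sub>m r * B * T)"
    unfolding TB using T B by (simp add: uminus_mult_mat[of _ n] assoc_mult_mat[of _ n n _ n _ n])
  also have "\<dots> = - (C * T ^\<^sub>m r * T)" using Suc.IH by (simp add: C_def)
  also have "\<dots> = - C * T ^\<^sub>m Suc r"
    using T by (simp add: uminus_mult_mat[of _ n] assoc_mult_mat[of _ n n _ n _ n] mult_carrier_mat[of _ n n _ n])
  finally show ?case by (simp add: C_def)
qed

text \<open>On a Jordan matrix \<open>T\<close> without a zero block of size \<open>r + 1\<close>, \<open>S\<close> sends the bottom vector of each
  longer zero block to the vector that \<open>T\<^bsup>r + 1\<^esup>\<close> maps back to it, so \<open>T\<^bsup>r + 1\<^esup> S\<close> is a projection onto
  \<open>ker T \<inter> im T\<^bsup>r + 1\<^esup>\<close>. The equation involving \<open>X\<close> says that this space equals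
  \<open>ker T \<inter> im T\<^bsup>r\<^esup>\<close>, which is where the missing block size enters.\<close>

definition gap_witness :: "nat \<Rightarrow> nat \<Rightarrow> complex mat \<Rightarrow> nat \<Rightarrow> bool" where
  "gap_witness n r T d \<longleftrightarrow> (\<exists>S X. S \<in> carrier_mat n n \<and> X \<in> carrier_mat n n \<and>
     T * (T ^\<^sub>m Suc r * S) = 0\<^sub>m n n \<and> S * (T ^\<^sub>m Suc r * S) = S \<and> S * T ^\<^sub>m r * S = 0\<^sub>m n n \<and>
     T ^\<^sub>m r = T ^\<^sub>m Suc r * S * T ^\<^sub>m r + X * T ^\<^sub>m Suc r \<and> mat_trace (T ^\<^sub>m Suc r * S) = of_nat d)"

lemma gap_witness_even:
  assumes T: "square_zero_commutator n T" and gap: "gap_witness n r T d"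
  shows "even d"
proof -
  obtain M N where M: "M \<in> carrier_mat n n" "M * M = 0\<^sub>m n n"
    and N: "N \<in> carrier_mat n n" "N * N = 0\<^sub>m n n" and eq: "T = M * N - N * M"
    using T unfolding square_zero_commutator_def by blast
  have T: "T \<in> carrier_mat n n" unfolding eq using M N by (intro minus_carrier_mat) auto
  note [simp] = M(1) N(1) T
  obtain S X where [simp]: "S \<in> carrier_mat n n" "X \<in> carrier_mat n n"
    and S: "T * (T ^\<^sub>m Suc r * S) = 0\<^sub>m n n" "S * (T ^\<^sub>m Suc r * S) = S" "S * T ^\<^sub>m r * S = 0\<^sub>m n n"
    and X: "T ^\<^sub>m r = T ^\<^sub>m Suc r * S * T ^\<^sub>m r + X * T ^\<^sub>m Suc r" and tr: "mat_trace (T ^\<^sub>m Suc r * S) = of_nat d"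
    using gap unfolding gap_witness_def by blast
  \<comment> \<open>The sign (-1)^r from moving past T^r is put into both \<open>M'\<close> and
    \<open>N'\<close>, so it cancels in their commutator and in their squares.\<close>
  define M' where "M' = (if even r then M else - M)"
  define N' where "N' = (if even r then N else - N)"
  have [simp]: "M' \<in> carrier_mat n n" "N' \<in> carrier_mat n n" unfolding M'_def N'_def by auto
  note TMN = commutator_anticommutes[OF M N, folded eq]
  have eq': "T = M' * N' - N' * M'"
    unfolding M'_def N'_def by (simp add: eq uminus_mult_mat[of _ n])
  have sq': "M' * M' = 0\<^sub>m n n" "N' * N' = 0\<^sub>m n n"
    unfolding M'_def N'_def using M N by (auto simp: uminus_mult_mat[of _ n])
  have TMN': "T * M' = - (M' * T)" "T * N' = - (N' * T)"
    unfolding M'_def N'_def using TMN by (auto simp: uminus_mult_mat[of _ n])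
  have D: "T ^\<^sub>m r * M = M' * T ^\<^sub>m r" "T ^\<^sub>m r * N = N' * T ^\<^sub>m r"
    unfolding M'_def N'_def using anticommute_pow[OF T _ TMN(1)] anticommute_pow[OF T _ TMN(2)] by auto
  note comm = pow_mat_commute[OF T, of r]
  let ?R = "ring_mat TYPE(complex) n ()"
  interpret R: ring ?R by (rule ring_mat)
  have uminus: "\<ominus>\<^bsub>?R\<^esub> A = - A" if "A \<in> carrier_mat n n" for A
    using that by (intro R.minus_equality) (auto simp: ring_mat_simps)
  have minus: "A \<ominus>\<^bsub>?R\<^esub> B = A - B" if "A \<in> carrier_mat n n" "B \<in> carrier_mat n n" for A B
    using that by (simp add: a_minus_def uminus ring_mat_simps minus_add_uminus_mat)
  have carriers: "T \<in> carrier_mat n n" "M \<in> carrier_mat n n" "N \<in> carrier_mat n n" "M' \<in> carrier_mat n n"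
    "N' \<in> carrier_mat n n" "T ^\<^sub>m r \<in> carrier_mat n n" "S \<in> carrier_mat n n" "X \<in> carrier_mat n n" by simp_all
  have ring_eqs: "T = M * N \<ominus>\<^bsub>?R\<^esub> N * M" "T = M' * N' \<ominus>\<^bsub>?R\<^esub> N' * M'"
    using eq eq' minus[of "M * N" "N * M"] minus[of "M' * N'" "N' * M'"]
    by (simp_all add: mult_carrier_mat[of _ n n _ n])
  have ring_eqs': "T * M' = \<ominus>\<^bsub>?R\<^esub> (M' * T)" "T * N' = \<ominus>\<^bsub>?R\<^esub> (N' * T)"
    using TMN' uminus[of "M' * T"] uminus[of "N' * T"] by (simp_all add: mult_carrier_mat[of _ n n _ n])
  have corner: "T ^\<^sub>m Suc r * S = T * T ^\<^sub>m r * S" using comm by simp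
  have X': "T ^\<^sub>m r = T ^\<^sub>m Suc r * S * T ^\<^sub>m r + X * T * T ^\<^sub>m r"
    using X comm by (simp add: assoc_mult_mat[of _ n n _ n _ n])
  obtain u v where uv: "u \<in> carrier_mat n n" "u * u = u" "v \<in> carrier_mat n n" "v * v = v"
    and "mat_trace (T ^\<^sub>m Suc r * S) = 2 * mat_trace u + 2 * mat_trace v"
    by (rule R.commutator_corner_half_trace[unfolded ring_mat_simps, OF carriers complex_mat_regular
      ring_eqs N(2) sq' D ring_eqs' comm corner S X' mat_trace_add mat_trace_mult_commute])
  then have "of_nat d = 2 * mat_trace u + 2 * mat_trace v" using tr by simp
  moreover obtain a where "mat_trace u = of_nat a" using mat_trace_idempotent[OF uv(1,2)] by (auto elim: Nats_cases)
  moreover obtain b where "mat_trace v = of_nat b" using mat_trace_idempotent[OF uv(3,4)] by (auto elim: Nats_cases)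
  ultimately have "(of_nat d :: complex) = of_nat (2 * (a + b))" by simp
  then have "d = 2 * (a + b)" unfolding of_nat_eq_iff .
  then show ?thesis by simp
qed

section \<open>Gap witnesses for Jordan matrices\<close>

lemma gap_witness_dsum:
  assumes A: "gap_witness m r A c" "A \<in> carrier_mat m m" and B: "gap_witness n r B d" "B \<in> carrier_mat n n"
  shows "gap_witness (m + n) r (A \<oplus>\<^sub>m B) (c + d)"
proof -
  obtain S X where SX: "S \<in> carrier_mat m m" "X \<in> carrier_mat m m"
    "A * (A ^\<^sub>m Suc r * S) = 0\<^sub>m m m" "S * (A ^\<^sub>m Suc r * S) = S" "S * A ^\<^sub>m r * S = 0\<^sub>m m m"
    "A ^\<^sub>m r = A ^\<^sub>m Suc r * S * A ^\<^sub>m r + X * A ^\<^sub>m Suc r" "mat_trace (A ^\<^sub>m Suc r * S) = of_nat c"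
    using A(1) unfolding gap_witness_def by blast
  obtain S' X' where SX': "S' \<in> carrier_mat n n" "X' \<in> carrier_mat n n"
    "B * (B ^\<^sub>m Suc r * S') = 0\<^sub>m n n" "S' * (B ^\<^sub>m Suc r * S') = S'" "S' * B ^\<^sub>m r * S' = 0\<^sub>m n n"
    "B ^\<^sub>m r = B ^\<^sub>m Suc r * S' * B ^\<^sub>m r + X' * B ^\<^sub>m Suc r" "mat_trace (B ^\<^sub>m Suc r * S') = of_nat d"
    using B(1) unfolding gap_witness_def by blast
  have [simp]: "A ^\<^sub>m Suc r \<in> carrier_mat m m" "A ^\<^sub>m r \<in> carrier_mat m m"
    "B ^\<^sub>m Suc r \<in> carrier_mat n n" "B ^\<^sub>m r \<in> carrier_mat n n"
    using A(2) B(2) by (simp_all add: mult_carrier_mat[of _ m m _ m] mult_carrier_mat[of _ n n _ n] del: pow_mat.simps)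
  note [simp] = SX(1,2) SX'(1,2) A(2) B(2) mult_carrier_mat[of _ m m _ m] mult_carrier_mat[of _ n n _ n]
  note mult = dsum_mat_mult[of _ m _ _ n]
  let ?S = "S \<oplus>\<^sub>m S'" and ?X = "X \<oplus>\<^sub>m X'"
  show ?thesis
    unfolding gap_witness_def dsum_mat_pow[OF A(2) B(2)]
  proof (rule exI[of _ ?S], rule exI[of _ ?X], intro conjI)
    show "(A \<oplus>\<^sub>m B) * ((A ^\<^sub>m Suc r \<oplus>\<^sub>m B ^\<^sub>m Suc r) * ?S) = 0\<^sub>m (m + n) (m + n)"
      by (simp add: mult SX(3) SX'(3) dsum_mat_zero del: pow_mat.simps)
    show "?S * ((A ^\<^sub>m Suc r \<oplus>\<^sub>m B ^\<^sub>m Suc r) * ?S) = ?S"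
      by (simp add: mult SX(4) SX'(4) del: pow_mat.simps)
    show "?S * (A ^\<^sub>m r \<oplus>\<^sub>m B ^\<^sub>m r) * ?S = 0\<^sub>m (m + n) (m + n)"
      by (simp add: mult SX(5) SX'(5) dsum_mat_zero del: pow_mat.simps assoc_mult_mat)
    show "mat_trace ((A ^\<^sub>m Suc r \<oplus>\<^sub>m B ^\<^sub>m Suc r) * ?S) = of_nat (c + d)"
      by (simp add: mult mat_trace_dsum[of _ m _ n] SX(7) SX'(7) del: pow_mat.simps)
    show "A ^\<^sub>m r \<oplus>\<^sub>m B ^\<^sub>m r = (A ^\<^sub>m Suc r \<oplus>\<^sub>m B ^\<^sub>m Suc r) * ?S * (A ^\<^sub>m r \<oplus>\<^sub>m B ^\<^sub>m r) + ?X * (A ^\<^sub>m Suc r \<oplus>\<^sub>m B ^\<^sub>m Suc r)"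
      by (simp add: mult dsum_mat_add[of _ m _ _ n] SX(6)[symmetric] SX'(6)[symmetric] del: pow_mat.simps assoc_mult_mat)
  qed auto
qed

text \<open>The excluded block is the one where T^r has range ker T but T^(r+1) is already 0. An
  invertible block takes S = 0 and its inverse as X, a shorter zero block has T^r = 0, and a longer
  one contributes a single dimension.\<close>

lemma gap_witness_jordan_block:
  assumes "(k, a) \<noteq> (Suc r, 0)"
  shows "gap_witness k r (jordan_block k a) (if a = 0 \<and> Suc r < k then 1 else 0)"
proof -
  let ?J = "jordan_block k a"
  consider (inv) "a \<noteq> 0" | (small) "a = 0" "k \<le> r" | (large) "a = 0" "Suc r < k"
    using assms by fastforce
  then show ?thesis
  proof cases
    case inv
    obtain B where B: "B \<in> carrier_mat k k" "B * ?J = 1\<^sub>m k" "?J * B = 1\<^sub>m k"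
      using jordan_block_inverse[OF inv] by metis
    have J: "?J ^\<^sub>m r \<in> carrier_mat k k" by simp
    have "B * ?J ^\<^sub>m Suc r = ?J ^\<^sub>m r"
    proof (induction r)
      case 0
      then show ?case using B by simp
    next
      case (Suc r)
      have "B * ?J ^\<^sub>m Suc (Suc r) = B * ?J ^\<^sub>m Suc r * ?J"
        using B by (simp add: assoc_mult_mat[of _ k k _ k _ k] mult_carrier_mat[of _ k k _ k])
      then show ?case using Suc by simp
    qed
    then show ?thesis
      unfolding gap_witness_def using inv B(1)
      by (intro exI[of _ "0\<^sub>m k k"] exI[of _ B]) (simp add: mat_trace_def mult_carrier_mat[of _ k k _ k])
  next
    case small
    have "?J ^\<^sub>m r = 0\<^sub>m k k" "?J ^\<^sub>m Suc r = 0\<^sub>m k k"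
      unfolding small(1) jordan_block_zero_pow_row_select row_select_mat_def using small(2)
      by (auto intro!: eq_matI)
    then show ?thesis
      unfolding gap_witness_def using small
      by (intro exI[of _ "0\<^sub>m k k"]) (simp add: mat_trace_def del: pow_mat.simps)
  next
    case large
    define S where "S = (row_select_mat k (\<lambda>i. i = Suc r) (\<lambda>i. 0) :: complex mat)"
    \<comment> \<open>\<open>X\<close> is the transposed shift: \<open>X * ?J ^ Suc r\<close>
      recovers all rows of \<open>?J ^ r\<close> except the first, and the projection
      \<open>?J ^ Suc r * S\<close> recovers the first.\<close>
    define X where "X = (row_select_mat k (\<lambda>i. 0 < i) (\<lambda>i. i - 1) :: complex mat)"
    note [simp] = row_select_mat_mult_row_select
    have J: "?J = row_select_mat k (\<lambda>i. Suc i < k) Suc"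
      using jordan_block_zero_pow_row_select[of k 1, where 'a = complex] large by simp
    have E: "?J ^\<^sub>m Suc r * S = row_select_mat k (\<lambda>i. i = 0) (\<lambda>i. 0)"
      unfolding large(1) jordan_block_zero_pow_row_select S_def using large(2)
      by (simp del: pow_mat.simps) (auto simp: row_select_mat_def intro!: eq_matI)
    show ?thesis
      unfolding gap_witness_def
    proof (rule exI[of _ S], rule exI[of _ X], intro conjI)
      show "?J * (?J ^\<^sub>m Suc r * S) = 0\<^sub>m k k"
        unfolding E unfolding J by simp (auto simp: row_select_mat_def intro!: eq_matI)
      show "S * (?J ^\<^sub>m Suc r * S) = S"
        unfolding E unfolding S_def using large by simp
      show "S * ?J ^\<^sub>m r * S = 0\<^sub>m k k"
        unfolding large(1) jordan_block_zero_pow_row_select S_def using large(2)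
        by simp (auto simp: row_select_mat_def intro!: eq_matI)
      have "?J ^\<^sub>m Suc r * S * ?J ^\<^sub>m r = row_select_mat k (\<lambda>i. i = 0) (\<lambda>i. r)"
        unfolding E unfolding large(1) jordan_block_zero_pow_row_select using large(2)
        by (simp cong: conj_cong)
      moreover have "X * ?J ^\<^sub>m Suc r = row_select_mat k (\<lambda>i. 0 < i \<and> i + r < k) (\<lambda>i. i + r)"
        unfolding large(1) jordan_block_zero_pow_row_select X_def
        by (simp del: pow_mat.simps) (auto simp: row_select_mat_def intro!: eq_matI)
      ultimately show "?J ^\<^sub>m r = ?J ^\<^sub>m Suc r * S * ?J ^\<^sub>m r + X * ?J ^\<^sub>m Suc r"
        unfolding large(1) jordan_block_zero_pow_row_select using large(2)
        by (auto simp: row_select_mat_def intro!: eq_matI)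
      have "mat_trace (?J ^\<^sub>m Suc r * S) = (\<Sum>i<k. if i = 0 then 1 else 0)"
        unfolding E unfolding mat_trace_def row_select_mat_def by (intro sum.cong) auto
      then show "mat_trace (?J ^\<^sub>m Suc r * S) = of_nat (if a = 0 \<and> Suc r < k then 1 else 0)"
        using large by simp
    qed (auto simp: S_def X_def)
  qed
qed

lemma gap_witness_jordan_matrix:
  assumes "(Suc r, 0) \<notin> set xs"
  shows "gap_witness (sum_list (map fst xs)) r (jordan_matrix xs) (length (filter (\<lambda>(k, a). a = 0 \<and> Suc r < k) xs))"
  using assms
proof (induction xs)
  case Nil
  show ?case unfolding gap_witness_def
    by (intro exI[of _ "0\<^sub>m 0 0"]) (auto simp: mat_trace_def intro!: eq_matI)
next
  case (Cons x xs)
  obtain k a where x: "x = (k, a)" by force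
  have "gap_witness (k + sum_list (map fst xs)) r (jordan_block k a \<oplus>\<^sub>m jordan_matrix xs)
     ((if a = 0 \<and> Suc r < k then 1 else 0) + length (filter (\<lambda>(k, a). a = 0 \<and> Suc r < k) xs))"
    using Cons by (intro gap_witness_dsum gap_witness_jordan_block) (auto simp: x)
  then show ?case by (cases "a = 0 \<and> Suc r < k") (auto simp: x jordan_matrix_Cons_dsum)
qed

lemma square_zero_commutator_jordan_parity:
  fixes T :: "complex mat"
  assumes "square_zero_commutator n T" "similar_mat T (jordan_matrix xs)" "(Suc r, 0) \<notin> set xs"
  shows "even (length (filter (\<lambda>(k, a). a = 0 \<and> Suc r < k) xs))"
proof -
  have J: "square_zero_commutator n (jordan_matrix xs)"
    using square_zero_commutator_similar[OF similar_mat_sym[OF assms(2)] assms(1)] .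
  then have "jordan_matrix xs \<in> carrier_mat n n"
    unfolding square_zero_commutator_def by fastforce
  then have "n = sum_list (map fst xs)" by auto
  with J gap_witness_even[OF _ gap_witness_jordan_matrix[OF assms(3)]] show ?thesis by blast
qed

subsection \<open>The invertible part\<close>

text \<open>Uniqueness for a Sylvester equation: A X = - X B gives X = - A' X B, so by iteration X
  factors through every power of B, and B^k = 0 kills it. The second claim is the mirror
  image.\<close>

lemma anticommute_invertible_nilpotent:
  fixes A B :: "'a :: comm_ring_1 mat"
  assumes A: "A \<in> carrier_mat m m" and A': "A' \<in> carrier_mat m m" and inv: "A' * A = 1\<^sub>m m" "A * A' = 1\<^sub>m m"
    and B: "B \<in> carrier_mat n n" and nil: "B ^\<^sub>m k = 0\<^sub>m n n"
  shows "\<And>X. X \<in> carrier_mat m n \<Longrightarrow> A * X = - (X * B) \<Longrightarrow> X = 0\<^sub>m m n"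
    and "\<And>X. X \<in> carrier_mat n m \<Longrightarrow> B * X = - (X * A) \<Longrightarrow> X = 0\<^sub>m n m"
proof -
  fix X assume X: "X \<in> carrier_mat m n" and AX: "A * X = - (X * B)"
  have "X = A' * A * X" using inv X by simp
  also have "\<dots> = A' * (A * X)" using A A' X by simp
  finally have rec: "X = A' * - (X * B)" unfolding AX .
  have "\<exists>C \<in> carrier_mat m n. X = C * B ^\<^sub>m j" for j
  proof (induction j)
    case 0
    then show ?case using X B by (intro bexI[of _ X]) auto
  next
    case (Suc j)
    then obtain C where C: "C \<in> carrier_mat m n" "X = C * B ^\<^sub>m j" by blast
    have Bj: "B ^\<^sub>m j \<in> carrier_mat n n" using B by simp
    have "X = A' * - (C * B ^\<^sub>m j * B)" using rec C(2) by simp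
    also have "\<dots> = (A' * - C) * B ^\<^sub>m Suc j"
      using A' B Bj C(1) by (simp add: assoc_mult_mat[of _ m n _ n _ n] assoc_mult_mat[of _ m m _ n _ n] mult_carrier_mat[of _ n n _ n] mult_carrier_mat[of _ m n _ n])
    finally show ?case using A' C(1) by (intro bexI[of _ "A' * - C"]) auto
  qed
  from this[of k] show "X = 0\<^sub>m m n" unfolding nil by auto
next
  fix X assume X: "X \<in> carrier_mat n m" and BX: "B * X = - (X * A)"
  have "- (B * X) = X * A" unfolding BX by simp
  then have "- (B * X) * A' = X * (A * A')" using X A A' by simp
  then have rec: "X = - (B * X) * A'" using inv X by simp
  have "\<exists>C \<in> carrier_mat n m. X = B ^\<^sub>m j * C" for j
  proof (induction j)
    case 0
    then show ?case using X B by (intro bexI[of _ X]) auto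
  next
    case (Suc j)
    then obtain C where C: "C \<in> carrier_mat n m" "X = B ^\<^sub>m j * C" by blast
    have Bj: "B ^\<^sub>m j \<in> carrier_mat n n" using B by simp
    have "X = - (B * (B ^\<^sub>m j * C)) * A'" using rec C(2) by simp
    also have "\<dots> = B * B ^\<^sub>m j * (- C * A')"
      using A' B Bj C(1) by (simp add: assoc_mult_mat[of _ n n _ n _ m] assoc_mult_mat[of _ n n _ m _ m] mult_carrier_mat[of _ n n _ m] mult_carrier_mat[of _ n m _ m])
    finally show ?case using A' B C(1) pow_mat_commute[OF B, of j]
      by (intro bexI[of _ "- C * A'"]) auto
  qed
  from this[of k] show "X = 0\<^sub>m n m" unfolding nil by auto
qed

text \<open>The off-diagonal blocks of \<open>X\<close> intertwine an invertible with a nilpotent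
  matrix up to sign, hence vanish. This is how \<open>M\<close> and \<open>N\<close> are seen to
  respect the Fitting decomposition.\<close>

lemma anticommute_block_diagonal:
  fixes A B :: "'a :: comm_ring_1 mat"
  assumes A: "A \<in> carrier_mat m m" and A': "A' \<in> carrier_mat m m" and inv: "A' * A = 1\<^sub>m m" "A * A' = 1\<^sub>m m"
    and B: "B \<in> carrier_mat n n" and nil: "B ^\<^sub>m k = 0\<^sub>m n n"
    and X: "X \<in> carrier_mat (m + n) (m + n)" and anti: "(A \<oplus>\<^sub>m B) * X = - (X * (A \<oplus>\<^sub>m B))"
  obtains C D where "C \<in> carrier_mat m m" "D \<in> carrier_mat n n" "X = C \<oplus>\<^sub>m D"
proof -
  obtain C E F D where split: "split_block X m m = (C, E, F, D)" by (metis prod_cases4)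
  note blocks = split_block[OF split, of n n]
  have car: "C \<in> carrier_mat m m" "E \<in> carrier_mat m n" "F \<in> carrier_mat n m" "D \<in> carrier_mat n n"
    and Xeq: "X = four_block_mat C E F D" using blocks X by auto
  have AB: "A \<oplus>\<^sub>m B = four_block_mat A (0\<^sub>m m n) (0\<^sub>m n m) B" unfolding dsum_mat_def using A B by simp
  have "(A \<oplus>\<^sub>m B) * X = four_block_mat (A * C) (A * E) (B * F) (B * D)"
    unfolding AB Xeq using A B car
    by (subst mult_four_block_mat[of _ m m _ n _ n _ _ m _ n]) auto
  moreover have "X * (A \<oplus>\<^sub>m B) = four_block_mat (C * A) (E * B) (F * A) (D * B)"
    unfolding AB Xeq using A B car
    by (subst mult_four_block_mat[of _ m m _ n _ n _ _ m _ n]) auto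
  ultimately have eq: "four_block_mat (A * C) (A * E) (B * F) (B * D) = - four_block_mat (C * A) (E * B) (F * A) (D * B)"
    using anti by simp
  have "A * E = - (E * B)"
  proof (rule eq_matI)
    fix i j assume "i < dim_row (- (E * B))" "j < dim_col (- (E * B))"
    then show "(A * E) $$ (i,j) = (- (E * B)) $$ (i,j)"
      using arg_cong[OF eq, of "\<lambda>Y. Y $$ (i, m + j)"] A B car by (auto simp del: index_mult_mat(1))
  qed (use A B car in auto)
  from anticommute_invertible_nilpotent(1)[OF A A' inv B nil car(2) this] have E: "E = 0\<^sub>m m n" .
  have "B * F = - (F * A)"
  proof (rule eq_matI)
    fix i j assume "i < dim_row (- (F * A))" "j < dim_col (- (F * A))"
    then show "(B * F) $$ (i,j) = (- (F * A)) $$ (i,j)"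
      using arg_cong[OF eq, of "\<lambda>Y. Y $$ (m + i, j)"] A B car by (auto simp del: index_mult_mat(1))
  qed (use A B car in auto)
  from anticommute_invertible_nilpotent(2)[OF A A' inv B nil car(3) this] have F: "F = 0\<^sub>m n m" .
  show thesis using that[OF car(1,4)] Xeq E F car by (simp add: dsum_mat_def)
qed

lemma square_zero_commutator_similar_uminus:
  fixes A B :: "complex mat"
  assumes comm: "square_zero_commutator (m + n) (A \<oplus>\<^sub>m B)"
    and A: "A \<in> carrier_mat m m" and A': "A' \<in> carrier_mat m m" and inv: "A' * A = 1\<^sub>m m" "A * A' = 1\<^sub>m m"
    and B: "B \<in> carrier_mat n n" and nil: "B ^\<^sub>m k = 0\<^sub>m n n"
  shows "similar_mat A (- A)"
proof -
  define l where "l = m + n"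
  obtain M N where M: "M \<in> carrier_mat l l" "M * M = 0\<^sub>m l l"
    and N: "N \<in> carrier_mat l l" "N * N = 0\<^sub>m l l" and eq: "A \<oplus>\<^sub>m B = M * N - N * M"
    using comm unfolding square_zero_commutator_def l_def by blast
  note anti = commutator_anticommutes[OF M N, folded eq]
  obtain M1 M0 where M10: "M1 \<in> carrier_mat m m" "M0 \<in> carrier_mat n n" "M = M1 \<oplus>\<^sub>m M0"
    using anticommute_block_diagonal[OF A A' inv B nil _ anti(1)] M(1) unfolding l_def by blast
  obtain N1 N0 where N10: "N1 \<in> carrier_mat m m" "N0 \<in> carrier_mat n n" "N = N1 \<oplus>\<^sub>m N0"
    using anticommute_block_diagonal[OF A A' inv B nil _ anti(2)] N(1) unfolding l_def by blast
  note mult = dsum_mat_mult[of _ m _ _ n]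
  have "A \<oplus>\<^sub>m B = (M1 * N1 - N1 * M1) \<oplus>\<^sub>m (M0 * N0 - N0 * M0)"
    unfolding eq M10(3) N10(3) using M10(1,2) N10(1,2)
    by (simp add: mult dsum_mat_minus[of _ m _ _ n])
  \<comment> \<open>Restricting to the first block leaves the same problem for an invertible
    commutator alone.\<close>
  then have A_eq: "A = M1 * N1 - N1 * M1"
    using A B M10(1,2) N10(1,2) by (subst (asm) dsum_mat_eq_iff[of _ m _ _ n]) auto
  have M1: "M1 * M1 = 0\<^sub>m m m" and N1: "N1 * N1 = 0\<^sub>m m m"
  proof -
    have "M1 * M1 \<oplus>\<^sub>m M0 * M0 = 0\<^sub>m m m \<oplus>\<^sub>m 0\<^sub>m n n"
      using M(2) M10 by (simp add: mult dsum_mat_zero l_def)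
    then show "M1 * M1 = 0\<^sub>m m m" using M10 by (subst (asm) dsum_mat_eq_iff[of _ m _ _ n]) auto
    have "N1 * N1 \<oplus>\<^sub>m N0 * N0 = 0\<^sub>m m m \<oplus>\<^sub>m 0\<^sub>m n n"
      using N(2) N10 by (simp add: mult dsum_mat_zero l_def)
    then show "N1 * N1 = 0\<^sub>m m m" using N10 by (subst (asm) dsum_mat_eq_iff[of _ m _ _ n]) auto
  qed
  note anti1 = commutator_anticommutes[OF M10(1) M1 N10(1) N1, folded A_eq]
  define X where "X = M1 + N1"
  have X: "X \<in> carrier_mat m m" unfolding X_def using M10 N10 by simp
  have AX: "A * X = - X * A"
  proof -
    have "A * X = A * M1 + A * N1" unfolding X_def using A M10 N10 by (simp add: mult_add_distrib_mat[of _ m m _ m])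
    also have "\<dots> = - (M1 * A) + - (N1 * A)" using anti1 by simp
    also have "\<dots> = - (M1 * A + N1 * A)" using A M10(1) N10(1) by (intro eq_matI) auto
    also have "\<dots> = - (X * A)" unfolding X_def using A M10 N10 by (simp add: add_mult_distrib_mat[of _ m m _ _ m])
    finally show ?thesis using A X by (simp add: uminus_mult_mat[of _ m])
  qed
  \<comment> \<open>The relations give \<open>(M - N) (M + N) = M N - N M\<close>, so \<open>X\<close> inherits invertibility from \<open>A\<close>.\<close>
  have "(M1 - N1) * X = M1 * (M1 + N1) - N1 * (M1 + N1)"
    unfolding X_def using M10 N10 by (simp add: minus_mult_distrib_mat[of _ m m _ _ m])
  also have "\<dots> = (M1 * M1 + M1 * N1) - (N1 * M1 + N1 * N1)"
    using M10 N10 by (simp add: mult_add_distrib_mat[of _ m m _ m])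
  also have "\<dots> = A"
    unfolding M1 N1 A_eq using M10 N10 by (intro eq_matI) auto
  finally have fac: "(M1 - N1) * X = A" .
  define Y where "Y = A' * (M1 - N1)"
  have Y: "Y \<in> carrier_mat m m" unfolding Y_def using A' M10 N10 by auto
  have YX: "Y * X = 1\<^sub>m m"
    unfolding Y_def using assoc_mult_mat[OF A' minus_carrier_mat[OF N10(1)] X, of M1] fac inv by simp
  then have XY: "X * Y = 1\<^sub>m m" using mat_mult_left_right_inverse[OF Y X] by simp
  have "X * - A * Y = - X * A * Y" using A X by (simp add: uminus_mult_mat[of _ m])
  also have "\<dots> = A * (X * Y)" unfolding AX[symmetric] using A X Y by simp
  also have "\<dots> = A" unfolding XY using A by simp
  finally show ?thesis
    using A X Y XY YX by (intro similar_matI[of _ _ X Y m]) auto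
qed

section \<open>Jordan matrices by eigenvalue, and spectra symmetric under negation\<close>

lemma jordan_matrix_inverse:
  fixes xs :: "(nat \<times> 'a :: field) list"
  assumes "0 \<notin> snd ` set xs"
  shows "\<exists>B \<in> carrier_mat (sum_list (map fst xs)) (sum_list (map fst xs)).
    B * jordan_matrix xs = 1\<^sub>m (sum_list (map fst xs)) \<and> jordan_matrix xs * B = 1\<^sub>m (sum_list (map fst xs))"
  using assms
proof (induction xs)
  case Nil
  then show ?case by (intro bexI[of _ "0\<^sub>m 0 0"]) auto
next
  case (Cons x xs)
  obtain k a where x: "x = (k, a)" by force
  let ?n = "sum_list (map fst xs)"
  obtain B where B: "B \<in> carrier_mat ?n ?n" "B * jordan_matrix xs = 1\<^sub>m ?n" "jordan_matrix xs * B = 1\<^sub>m ?n"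
    using Cons by auto
  obtain C where C: "C \<in> carrier_mat k k" "jordan_block k a * C = 1\<^sub>m k" "C * jordan_block k a = 1\<^sub>m k"
    using jordan_block_inverse[of a k] Cons.prems x by auto
  show ?case using B C
    by (intro bexI[of _ "C \<oplus>\<^sub>m B"])
      (simp_all add: x jordan_matrix_Cons_dsum dsum_mat_mult[of _ k _ _ ?n] dsum_mat_one)
qed

lemma nilpotent_jordan_matrix:
  fixes xs :: "(nat \<times> 'a :: field) list"
  assumes "snd ` set xs \<subseteq> {0}"
  shows "jordan_matrix xs ^\<^sub>m sum_list (map fst xs) = 0\<^sub>m (sum_list (map fst xs)) (sum_list (map fst xs))"
proof -
  \<comment> \<open>The exponent is any \<open>p\<close> above the total size, so the same
    \<open>p\<close> serves the shorter list in the induction.\<close>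
  have "jordan_matrix xs ^\<^sub>m p = 0\<^sub>m (sum_list (map fst xs)) (sum_list (map fst xs))"
    if "sum_list (map fst xs) \<le> p" for p
    using assms that
  proof (induction xs)
    case Nil
    have "0\<^sub>m 0 0 ^\<^sub>m p \<in> carrier_mat 0 (0 :: nat)" by simp
    then show ?case by (auto intro!: eq_matI)
  next
    case (Cons x xs)
    obtain k where x: "x = (k, 0)" using Cons.prems by (cases x) auto
    let ?n = "sum_list (map fst xs)"
    have "jordan_block k (0 :: 'a) ^\<^sub>m p = 0\<^sub>m k k"
      unfolding jordan_block_zero_pow using Cons.prems x by (auto intro!: eq_matI)
    then show ?case using Cons
      by (simp add: x jordan_matrix_Cons_dsum dsum_mat_pow[of _ k _ ?n] dsum_mat_zero)
  qed
  then show ?thesis by simp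
qed

text \<open>The number of blocks of given positive size and eigenvalue is computed from
  \<open>A\<close> alone; blocks of size 0 are ruled out by \<open>jordan_nf\<close>.\<close>

lemma jordan_nf_mset_unique:
  fixes A :: "'a :: field mat"
  assumes xs: "jordan_nf A xs" and ys: "jordan_nf A ys"
  shows "mset xs = mset ys"
proof (rule multiset_eqI)
  fix x :: "nat \<times> 'a"
  obtain k a where x: "x = (k, a)" by force
  show "count (mset xs) x = count (mset ys) x"
  proof (cases "k = 0")
    case True
    then have "x \<notin> set xs" "x \<notin> set ys" using xs ys x unfolding jordan_nf_def by force+
    then show ?thesis by (simp add: count_eq_zero_iff[THEN iffD2])
  next
    case False
    then show ?thesis
      using compute_nr_of_jordan_blocks[OF xs False, of a] compute_nr_of_jordan_blocks[OF ys False, of a]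
      by (simp add: x count_mset count_list_eq_length_filter)
  qed
qed

text \<open>Selects exactly one number from each pair a, -a with a non-zero.\<close>

definition half_plane :: "complex \<Rightarrow> bool" where
  "half_plane a \<longleftrightarrow> Re a > 0 \<or> Re a = 0 \<and> Im a > 0"

lemma half_plane_uminus: "a \<noteq> 0 \<Longrightarrow> half_plane (- a) \<longleftrightarrow> \<not> half_plane a"
  unfolding half_plane_def by (auto simp: complex_eq_iff)

text \<open>Uniqueness of the Jordan form makes the multiset of blocks invariant under negating
  eigenvalues. The blocks with eigenvalue in the half plane form \<open>ys\<close>, and the
  remaining ones are their negatives.\<close>

lemma symmetric_jordan_matrix_split:
  fixes xs :: "(nat \<times> complex) list"
  assumes sim: "similar_mat (jordan_matrix xs) (- jordan_matrix xs)"
    and nonzero: "0 \<notin> snd ` set xs" "0 \<notin> fst ` set xs"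
  obtains ys where "set ys \<subseteq> set xs" "similar_mat (jordan_matrix xs) (jordan_matrix ys \<oplus>\<^sub>m - jordan_matrix ys)"
proof -
  \<comment> \<open>The form \<open>- 1 * a\<close> fits negation as scaling by -1 in
    \<open>jordan_nf_smult\<close>.\<close>
  let ?neg = "\<lambda>(k :: nat, a :: complex). (k, - 1 * a)"
  have uminus: "- jordan_matrix ys = (- 1) \<cdot>\<^sub>m jordan_matrix ys" for ys :: "(nat \<times> complex) list"
    by (intro eq_matI) auto
  have nf: "jordan_nf (jordan_matrix xs) xs"
    unfolding jordan_nf_def using nonzero similar_mat_refl[OF jordan_matrix_carrier] by auto
  have "jordan_nf (- jordan_matrix xs) (map ?neg xs)"
    unfolding uminus by (rule jordan_nf_smult[OF nf]) simp
  then have "jordan_nf (jordan_matrix xs) (map ?neg xs)"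
    unfolding jordan_nf_def using similar_mat_trans[OF sim] by blast
  from jordan_nf_mset_unique[OF nf this] have sym: "mset xs = mset (map ?neg xs)" .
  define ys where "ys = filter (\<lambda>x. half_plane (snd x)) xs"
  have flip: "half_plane (snd (?neg x)) \<longleftrightarrow> \<not> half_plane (snd x)" if "x \<in> set xs" for x
  proof -
    obtain k a where x: "x = (k, a)" by force
    have "a \<noteq> 0" using that nonzero(1) unfolding x by (metis imageI snd_conv)
    then show ?thesis using half_plane_uminus[of a] by (simp add: x)
  qed
  have "filter (\<lambda>x. \<not> half_plane (snd x)) (map ?neg xs) = map ?neg ys"
    unfolding ys_def filter_map o_def using flip
    by (intro arg_cong[where f = "map ?neg"] filter_cong refl) blast
  moreover have "mset (filter (\<lambda>x. \<not> half_plane (snd x)) xs) = mset (filter (\<lambda>x. \<not> half_plane (snd x)) (map ?neg xs))"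
    using sym by (metis mset_filter)
  ultimately have "mset xs = mset (ys @ map ?neg ys)"
    unfolding ys_def by (metis mset_append mset_filter multiset_partition)
  then have "similar_mat (jordan_matrix xs) (jordan_matrix ys \<oplus>\<^sub>m jordan_matrix (map ?neg ys))"
    using similar_mat_jordan_matrix_mset[of xs "ys @ map ?neg ys"] by (simp add: jordan_matrix_append)
  moreover have "similar_mat (jordan_matrix ys \<oplus>\<^sub>m jordan_matrix (map ?neg ys)) (jordan_matrix ys \<oplus>\<^sub>m - jordan_matrix ys)"
    unfolding uminus
    by (intro similar_mat_dsum similar_mat_refl[OF jordan_matrix_carrier] similar_mat_sym[OF similar_mat_jordan_matrix_smult]) simp
  ultimately have "similar_mat (jordan_matrix xs) (jordan_matrix ys \<oplus>\<^sub>m - jordan_matrix ys)"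
    by (rule similar_mat_trans)
  then show thesis using that[of ys] unfolding ys_def by simp
qed

subsection \<open>Square roots of nilpotent Jordan matrices\<close>

lemma antidiagonal_square:
  fixes B C :: "'a :: semiring_1 mat"
  assumes "B \<in> carrier_mat m n" "C \<in> carrier_mat n m"
  shows "\<exists>L \<in> carrier_mat (m + n) (m + n). L * L = B * C \<oplus>\<^sub>m C * B"
proof (rule bexI)
  show "four_block_mat (0\<^sub>m m m) B C (0\<^sub>m n n) * four_block_mat (0\<^sub>m m m) B C (0\<^sub>m n n) = B * C \<oplus>\<^sub>m C * B"
    using assms by (subst mult_four_block_mat[of _ m m _ n _ n _ _ m _ n]) (auto simp: dsum_mat_def)
qed auto

lemma jordan_blocks_square_same:
  "\<exists>L \<in> carrier_mat (m + m) (m + m). L * L = jordan_block m (0 :: 'a :: field) \<oplus>\<^sub>m jordan_block m 0"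
  using antidiagonal_square[of "1\<^sub>m m" m m "jordan_block m (0 :: 'a)"] by simp

text \<open>The shift on m + 1 coordinates factors through m coordinates: \<open>C\<close> drops the
  first coordinate and \<open>B\<close> embeds into the first m. The product in the other order is
  the shift on m coordinates.\<close>

lemma jordan_blocks_square_Suc:
  "\<exists>L \<in> carrier_mat (Suc m + m) (Suc m + m). L * L = jordan_block (Suc m) (0 :: 'a :: field) \<oplus>\<^sub>m jordan_block m 0"
proof -
  define B :: "'a mat" where "B = mat (Suc m) m (\<lambda>(i,j). if i = j then 1 else 0)"
  define C :: "'a mat" where "C = mat m (Suc m) (\<lambda>(i,j). if Suc i = j then 1 else 0)"
  have BC: "B * C = jordan_block (Suc m) 0"
  proof (rule eq_matI)
    fix i j assume ij: "i < dim_row (jordan_block (Suc m) (0 :: 'a))" "j < dim_col (jordan_block (Suc m) (0 :: 'a))"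
    then have "(B * C) $$ (i,j) = (\<Sum>k<m. (if i = k then 1 else 0) * (if Suc k = j then 1 else 0))"
      unfolding B_def C_def by (simp add: scalar_prod_def lessThan_atLeast0)
    also have "\<dots> = (\<Sum>k<m. if k = i then (if Suc i = j then 1 else 0) else 0)"
      by (intro sum.cong) auto
    also have "\<dots> = jordan_block (Suc m) 0 $$ (i,j)" using ij by auto
    finally show "(B * C) $$ (i,j) = jordan_block (Suc m) 0 $$ (i,j)" .
  qed (auto simp: B_def C_def)
  have CB: "C * B = jordan_block m 0"
  proof (rule eq_matI)
    fix i j assume ij: "i < dim_row (jordan_block m (0 :: 'a))" "j < dim_col (jordan_block m (0 :: 'a))"
    then have "(C * B) $$ (i,j) = (\<Sum>k<Suc m. (if Suc i = k then 1 else 0) * (if k = j then 1 else 0))"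
      unfolding B_def C_def by (simp add: scalar_prod_def lessThan_atLeast0 del: sum.lessThan_Suc sum.op_ivl_Suc)
    also have "\<dots> = (\<Sum>k<Suc m. if k = Suc i then (if Suc i = j then 1 else 0) else 0)"
      by (intro sum.cong) auto
    also have "\<dots> = jordan_block m 0 $$ (i,j)" using ij by auto
    finally show "(C * B) $$ (i,j) = jordan_block m 0 $$ (i,j)" .
  qed (auto simp: B_def C_def)
  show ?thesis using antidiagonal_square[of B "Suc m" m C] unfolding BC CB by (simp add: B_def C_def)
qed

text \<open>The multisets that split into pairs \<open>{m, m}\<close> and \<open>{m + 1, m}\<close>, a singleton \<open>{1}\<close> being
  paired with an empty block.\<close>

definition pairable :: "nat multiset \<Rightarrow> bool" where
  "pairable Z \<longleftrightarrow> 0 \<notin># Z \<and> (\<forall>r. Suc r \<notin># Z \<longrightarrow> even (size {#k \<in># Z. Suc r < k#}))"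

text \<open>Pairs are split off greedily from the maximum m. If m occurs twice, both copies go; if
  it occurs once and m > 1, the parity condition forces m - 1 to occur, and m goes with it; if m = 1
  occurs once, nothing else is left.\<close>

lemma pairable_cases:
  assumes "pairable Z" "Z \<noteq> {#}"
  obtains (same) m Y where "Z = {#m, m#} + Y" "pairable Y"
    | (Suc) m Y where "Z = {#Suc m, m#} + Y" "pairable Y"
    | (one) "Z = {#1#}"
proof -
  define m where "m = Max_mset Z"
  have m: "m \<in># Z" and le: "\<And>k. k \<in># Z \<Longrightarrow> k \<le> m" using assms(2) by (auto simp: m_def)
  then obtain W where W: "Z = add_mset m W" by (metis multi_member_split)
  have above: "{#k \<in># Y. Suc r < k#} = {#}" if "Y \<subseteq># Z" "m \<le> Suc r" for Y r
    using le that by (force simp: filter_mset_eq_conv dest: mset_subset_eqD)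
  have pos: "0 < m" using m assms(1) unfolding pairable_def by (metis gr0I)
  show thesis
  proof (cases "m \<in># W")
    case True
    then obtain Y where Y: "W = add_mset m Y" by (metis multi_member_split)
    \<comment> \<open>Below m the removed pair lowers the count by two; from m on, nothing is left
      to count, even if m itself has just disappeared.\<close>
    have "even (size {#k \<in># Y. Suc r < k#})" if "Suc r \<notin># Y" for r
    proof (cases "Suc r < m")
      case True
      then have "even (size {#k \<in># Z. Suc r < k#})" using assms(1) that W Y unfolding pairable_def by auto
      then show ?thesis using True W Y by simp
    next
      case False
      then have "{#k \<in># Y. Suc r < k#} = {#}" using W Y by (intro above) auto
      then show ?thesis by (metis even_zero size_empty)
    qed
    then have "pairable Y" using assms(1) W Y unfolding pairable_def by auto
    then show thesis using same[of m Y] W Y by simp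
  next
    case False
    show thesis
    proof (cases "m = 1")
      case True
      have "W = {#}"
      proof (rule ccontr)
        assume "W \<noteq> {#}"
        then obtain k where k: "k \<in># W" by blast
        then have "k \<le> 1" "k \<noteq> 0" "k \<noteq> 1" using le W True False assms(1) unfolding pairable_def by (auto intro!: Nat.gr0I)
        then show False by simp
      qed
      then show thesis using one W True by simp
    next
      case False
      then obtain l where l: "m = Suc (Suc l)" using pos by (metis One_nat_def not0_implies_Suc not_gr_zero)
      have Wl: "k \<le> Suc l" if "k \<in># W" for k using le[of k] that \<open>m \<notin># W\<close> W l by (cases "k = m") auto
      \<comment> \<open>If m - 1 were missing, m would be the only entry above it, an odd
        count.\<close>
      have "Suc l \<in># W"
      proof (rule ccontr)
        assume "Suc l \<notin># W"
        then have "Suc l \<notin># Z" using W l by simp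
        then have "even (size {#k \<in># Z. Suc l < k#})" using assms(1) unfolding pairable_def by blast
        moreover have "{#k \<in># W. Suc l < k#} = {#}" using Wl by (force simp: filter_mset_eq_conv)
        ultimately show False using W l by simp
      qed
      then obtain Y where Y: "W = add_mset (Suc l) Y" by (metis multi_member_split)
      \<comment> \<open>The size m - 1 may have become absent from \<open>Y\<close>, but no entry of
        \<open>Y\<close> exceeds it.\<close>
      have "even (size {#k \<in># Y. Suc r < k#})" if "Suc r \<notin># Y" for r
      proof (cases "Suc r < Suc l")
        case True
        then have "Suc r \<notin># Z" using that W Y l by simp
        then have "even (size {#k \<in># Z. Suc r < k#})" using assms(1) unfolding pairable_def by blast
        then show ?thesis using True W Y l by simp
      next
        case False
        then have "{#k \<in># Y. Suc r < k#} = {#}" using Wl Y by (force simp: filter_mset_eq_conv)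
        then show ?thesis by (metis even_zero size_empty)
      qed
      then have "pairable Y" using assms(1) W Y unfolding pairable_def by auto
      then show thesis using Suc[of "Suc l" Y] W Y l by simp
    qed
  qed
qed

lemma similar_mat_square_of_dsum:
  fixes A B :: "'a :: semiring_1 mat"
  assumes "similar_mat X (A \<oplus>\<^sub>m B)" "K \<in> carrier_mat m m" "K * K = A" "L \<in> carrier_mat n n" "similar_mat B (L * L)"
  shows "K \<oplus>\<^sub>m L \<in> carrier_mat (m + n) (m + n)" "similar_mat X ((K \<oplus>\<^sub>m L) * (K \<oplus>\<^sub>m L))"
proof -
  have "similar_mat (A \<oplus>\<^sub>m B) (K * K \<oplus>\<^sub>m L * L)"
    using assms by (intro similar_mat_dsum) (auto intro: similar_mat_refl[of _ m])
  then show "similar_mat X ((K \<oplus>\<^sub>m L) * (K \<oplus>\<^sub>m L))"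
    using assms similar_mat_trans by (simp add: dsum_mat_mult[of _ m _ _ n]) blast
qed (use assms in simp)

lemma pairable_jordan_matrix_square:
  fixes zs :: "nat list"
  assumes "pairable (mset zs)"
  shows "\<exists>L \<in> carrier_mat (sum_list zs) (sum_list zs).
    similar_mat (jordan_matrix (map (\<lambda>k. (k, 0 :: complex)) zs)) (L * L)"
  using assms
proof (induction "length zs" arbitrary: zs rule: less_induct)
  case less
  let ?J = "\<lambda>zs. jordan_matrix (map (\<lambda>k. (k, 0 :: complex)) zs)"
  have perm: "similar_mat (?J zs) (?J us)" "sum_list zs = sum_list us" "length zs = length us"
    if "mset zs = mset us" for us
  proof -
    show "similar_mat (?J zs) (?J us)" using that by (intro similar_mat_jordan_matrix_mset) simp
    show "sum_list zs = sum_list us" using that by (metis sum_mset_sum_list)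
    show "length zs = length us" using that by (rule mset_eq_length)
  qed
  show ?case
  proof (cases "mset zs = {#}")
    case True
    then show ?thesis by (intro bexI[of _ "0\<^sub>m 0 0"]) (auto intro: similar_mat_refl[of _ 0])
  next
    case False
    \<comment> \<open>A square root \<open>K\<close> of the two split-off blocks is joined to the
      root of the remaining blocks given by induction.\<close>
    have step: ?thesis
      if Z: "mset zs = {#a, b#} + Y" "pairable Y" and K: "K \<in> carrier_mat (a + b) (a + b)" "K * K = jordan_block a 0 \<oplus>\<^sub>m jordan_block b 0"
      for a b Y and K :: "complex mat"
    proof -
      obtain us where us: "mset us = Y" using ex_mset by blast
      have zs: "mset zs = mset (a # b # us)" using Z us by simp
      obtain L where L: "L \<in> carrier_mat (sum_list us) (sum_list us)" "similar_mat (?J us) (L * L)"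
        using less.hyps[of us] perm(3)[OF zs] us Z by auto
      have "similar_mat (?J zs) ((jordan_block a 0 \<oplus>\<^sub>m jordan_block b 0) \<oplus>\<^sub>m ?J us)"
        using perm(1)[OF zs] by (simp add: jordan_matrix_Cons_dsum dsum_mat_assoc)
      from similar_mat_square_of_dsum[OF this K L] show ?thesis
        using perm(2)[OF zs] by (intro bexI[of _ "K \<oplus>\<^sub>m L"]) (auto simp: add.assoc)
    qed
    from less.prems False show ?thesis
    proof (cases rule: pairable_cases)
      case (same m Y)
      then show ?thesis using step[of m m Y] jordan_blocks_square_same[of m] by blast
    next
      case (Suc m Y)
      then show ?thesis using step[of "Suc m" m Y] jordan_blocks_square_Suc[of m] by blast
    next
      case one
      then have zs: "zs = [1]" by simp
      \<comment> \<open>The unpaired block is the zero matrix of size 1, its own square.\<close>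
      have "jordan_block 1 (0 :: complex) = 0\<^sub>m 1 1 * 0\<^sub>m 1 1" by (intro eq_matI) auto
      then show ?thesis unfolding zs
        by (intro bexI[of _ "0\<^sub>m 1 1"]) (auto simp: jordan_matrix_Cons_dsum intro: similar_mat_refl[of _ 1])
    qed
  qed
qed

subsection \<open>The equivalence\<close>

lemma pow_mat_square:
  fixes L :: "'a :: semiring_1 mat"
  assumes L: "L \<in> carrier_mat n n"
  shows "(L * L) ^\<^sub>m p = L ^\<^sub>m (2 * p)"
proof (induction p)
  case 0
  then show ?case using L by simp
next
  case (Suc p)
  then show ?case using L by (simp add: assoc_mult_mat[of _ n n _ n _ n])
qed

lemma nilpotent_mat_of_square:
  assumes L: "L \<in> carrier_mat n n" and sim: "similar_mat B (L * L)" and nil: "B ^\<^sub>m p = 0\<^sub>m n n"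
  shows "nilpotent_mat L"
proof -
  obtain P Q where wit: "similar_mat_wit (L * L) B P Q"
    using similar_mat_sym[OF sim] unfolding similar_mat_def by blast
  have PQ: "P \<in> carrier_mat n n" "Q \<in> carrier_mat n n"
    using similar_mat_witD2[OF mult_carrier_mat[OF L L] wit] by auto
  have "L ^\<^sub>m (2 * p) = P * B ^\<^sub>m p * Q"
    using similar_mat_wit_pow_id[OF wit, of p] pow_mat_square[OF L] by simp
  also have "\<dots> = 0\<^sub>m n n" using PQ unfolding nil by simp
  finally show ?thesis unfolding nilpotent_mat_def using L by auto
qed

lemma square_zero_commutator_imp_canonical_form:
  fixes T :: "complex mat"
  assumes T: "square_zero_commutator n T"
  shows "\<exists>k A L. 2 * k \<le> n \<and> A \<in> carrier_mat k k \<and> invertible_mat A \<and>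
    L \<in> carrier_mat (n - 2 * k) (n - 2 * k) \<and> nilpotent_mat L \<and> similar_mat T ((A \<oplus>\<^sub>m (- A)) \<oplus>\<^sub>m (L * L))"
proof -
  have Tc: "T \<in> carrier_mat n n" using T unfolding square_zero_commutator_def by fastforce
  obtain xs where nf: "jordan_nf T xs" using complex_jordan_nf_exists[OF Tc] .
  then have sim: "similar_mat T (jordan_matrix xs)" and fst: "0 \<notin> fst ` set xs" unfolding jordan_nf_def by auto
  define us where "us = filter (\<lambda>x. snd x \<noteq> 0) xs"
  define vs where "vs = filter (\<lambda>x. snd x = 0) xs"
  define zs where "zs = map fst vs"
  let ?U = "jordan_matrix us" and ?V = "jordan_matrix vs"
  let ?m = "sum_list (map fst us)" and ?l = "sum_list (map fst vs)"
  have "mset xs = mset (us @ vs)"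
    unfolding us_def vs_def using multiset_partition[of "mset xs" "\<lambda>x. snd x \<noteq> 0"] by simp
  then have simUV: "similar_mat T (?U \<oplus>\<^sub>m ?V)"
    using similar_mat_trans[OF sim similar_mat_jordan_matrix_mset[of xs "us @ vs"]] by (simp add: jordan_matrix_append)
  have "?U \<oplus>\<^sub>m ?V \<in> carrier_mat n n" using similar_matD[OF simUV] Tc by auto
  then have n: "n = ?m + ?l" by auto
  have commUV: "square_zero_commutator (?m + ?l) (?U \<oplus>\<^sub>m ?V)"
    using square_zero_commutator_similar[OF similar_mat_sym[OF simUV] T] unfolding n .
  have us: "0 \<notin> snd ` set us" "0 \<notin> fst ` set us" using fst unfolding us_def by auto
  have "snd ` set vs \<subseteq> {0}" unfolding vs_def by auto
  note nil = nilpotent_jordan_matrix[OF this]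
  obtain U' where U': "U' \<in> carrier_mat ?m ?m" "U' * ?U = 1\<^sub>m ?m" "?U * U' = 1\<^sub>m ?m"
    using jordan_matrix_inverse[OF us(1)] by blast
  have "similar_mat ?U (- ?U)"
    using square_zero_commutator_similar_uminus[OF commUV _ U'(1-3) _ nil] by simp
  then obtain ys where ys: "set ys \<subseteq> set us" and simU: "similar_mat ?U (jordan_matrix ys \<oplus>\<^sub>m - jordan_matrix ys)"
    using symmetric_jordan_matrix_split us by blast
  define A where "A = jordan_matrix ys"
  define k where "k = sum_list (map fst ys)"
  have A: "A \<in> carrier_mat k k" unfolding A_def k_def by simp
  have "0 \<notin> snd ` set ys" using ys us(1) by blast
  then obtain A' where "A' \<in> carrier_mat k k" "A' * A = 1\<^sub>m k" "A * A' = 1\<^sub>m k"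
    using jordan_matrix_inverse unfolding A_def k_def by blast
  then have inv: "invertible_mat A"
    unfolding invertible_mat_def inverts_mat_def using A by auto
  \<comment> \<open>The similarity to the direct sum of \<open>A\<close> and \<open>- A\<close>
    shows that the size of the invertible part is even.\<close>
  have "?U \<in> carrier_mat (k + k) (k + k)"
  proof -
    obtain l where "{?U, A \<oplus>\<^sub>m - A} \<subseteq> carrier_mat l l" using similar_matD[OF simU] unfolding A_def by fast
    then show ?thesis using A by auto
  qed
  then have m: "?m = 2 * k" by auto
  have vs: "vs = map (\<lambda>k. (k, 0)) zs"
    unfolding zs_def map_map by (rule map_idI[symmetric]) (auto simp: vs_def)
  have "pairable (mset zs)"
    unfolding pairable_def
  proof (intro conjI allI impI)
    show "0 \<notin># mset zs" using fst unfolding zs_def vs_def by auto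
    fix r assume "Suc r \<notin># mset zs"
    then have "(Suc r, 0) \<notin> set xs" unfolding zs_def vs_def by force
    from square_zero_commutator_jordan_parity[OF T sim this]
    have "even (length (filter (\<lambda>(k, a). a = 0 \<and> Suc r < k) xs))" .
    also have "length (filter (\<lambda>(k, a). a = 0 \<and> Suc r < k) xs) = length (filter (\<lambda>k. Suc r < k) zs)"
      unfolding zs_def vs_def by (induction xs) auto
    also have "\<dots> = size {#k \<in># mset zs. Suc r < k#}" by (metis mset_filter size_mset)
    finally show "even (size {#k \<in># mset zs. Suc r < k#})" .
  qed
  from pairable_jordan_matrix_square[OF this, folded vs]
  obtain L where L: "L \<in> carrier_mat ?l ?l" and simV: "similar_mat ?V (L * L)" unfolding zs_def by blast
  have "similar_mat T ((A \<oplus>\<^sub>m (- A)) \<oplus>\<^sub>m (L * L))"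
    using similar_mat_trans[OF simUV similar_mat_dsum[OF simU simV]] unfolding A_def .
  moreover have "n - 2 * k = ?l" "2 * k \<le> n" using n m by auto
  ultimately show ?thesis
    using A inv L nilpotent_mat_of_square[OF L simV nil] by metis
qed

section \<open>The converse: explicit square-zero commutators\<close>

lemma square_zero_commutator_dsum_uminus:
  fixes A :: "'a :: comm_ring_1 mat"
  assumes A: "A \<in> carrier_mat k k"
  shows "square_zero_commutator (k + k) (A \<oplus>\<^sub>m (- A))"
proof -
  \<comment> \<open>With \<open>A\<close> in the upper right corner of \<open>M\<close> and the
    identity in the lower left corner of \<open>N\<close>, the products \<open>M N\<close> and
    \<open>N M\<close> place \<open>A\<close> in the first and in the second diagonal block.\<close>
  define M where "M = four_block_mat (0\<^sub>m k k) A (0\<^sub>m k k) (0\<^sub>m k k)"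
  define N :: "'a mat" where "N = four_block_mat (0\<^sub>m k k) (0\<^sub>m k k) (1\<^sub>m k) (0\<^sub>m k k)"
  note mult = mult_four_block_mat[of _ k k _ k _ k _ _ k _ k]
  have "M * M = 0\<^sub>m (k + k) (k + k)" "N * N = 0\<^sub>m (k + k) (k + k)"
    unfolding M_def N_def using A by (simp_all add: mult)
  moreover have "M * N = four_block_mat A (0\<^sub>m k k) (0\<^sub>m k k) (0\<^sub>m k k)"
    "N * M = four_block_mat (0\<^sub>m k k) (0\<^sub>m k k) (0\<^sub>m k k) A"
    unfolding M_def N_def using A by (simp_all add: mult)
  then have "A \<oplus>\<^sub>m (- A) = M * N - N * M"
    unfolding dsum_mat_def using A by (intro eq_matI) auto
  moreover have "M \<in> carrier_mat (k + k) (k + k)" "N \<in> carrier_mat (k + k) (k + k)"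
    unfolding M_def N_def using A by auto
  ultimately show ?thesis unfolding square_zero_commutator_def by blast
qed

definition weighted_shift :: "nat \<Rightarrow> (nat \<Rightarrow> 'a) \<Rightarrow> 'a :: comm_ring_1 mat" where
  "weighted_shift k f = mat k k (\<lambda>(i,j). if j = Suc i then f i else 0)"

lemma weighted_shift_mult:
  "weighted_shift k f * weighted_shift k g = mat k k (\<lambda>(i,j). if j = Suc (Suc i) then f i * g (Suc i) else 0)"
proof (rule eq_matI)
  fix i j assume "i < dim_row (mat k k (\<lambda>(i,j). if j = Suc (Suc i) then f i * g (Suc i) else 0))"
    "j < dim_col (mat k k (\<lambda>(i,j). if j = Suc (Suc i) then f i * g (Suc i) else 0))"
  then have ij: "i < k" "j < k" by auto
  then have "(weighted_shift k f * weighted_shift k g) $$ (i,j) =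
      (\<Sum>l<k. (if l = Suc i then f i else 0) * (if j = Suc l then g l else 0))"
    unfolding weighted_shift_def by (simp add: scalar_prod_def lessThan_atLeast0)
  also have "\<dots> = (\<Sum>l<k. if l = Suc i then (if j = Suc (Suc i) then f i * g (Suc i) else 0) else 0)"
    by (intro sum.cong) auto
  also have "\<dots> = (if j = Suc (Suc i) then f i * g (Suc i) else 0)" using ij by auto
  finally show "(weighted_shift k f * weighted_shift k g) $$ (i,j) =
      mat k k (\<lambda>(i,j). if j = Suc (Suc i) then f i * g (Suc i) else 0) $$ (i,j)" using ij by simp
qed (auto simp: weighted_shift_def)

text \<open>The weights alternate between \<open>M\<close> and \<open>N\<close>, with sign pattern \<open>+ + - -\<close> so that the
  consecutive products, which carry alternating signs in \<open>M N - N M\<close>, all become \<open>1\<close>.\<close>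

lemma square_zero_commutator_jordan_block_square:
  "square_zero_commutator k (jordan_block k (0 :: 'a :: comm_ring_1) * jordan_block k 0)"
proof -
  define M :: "'a mat" where "M = weighted_shift k (\<lambda>i. if even i then (- 1) ^ (i div 2) else 0)"
  define N :: "'a mat" where "N = weighted_shift k (\<lambda>i. if odd i then (- 1) ^ (i div 2) else 0)"
  have J: "jordan_block k (0 :: 'a) = weighted_shift k (\<lambda>i. 1)"
    unfolding weighted_shift_def by (intro eq_matI) auto
  have sq: "((- 1) ^ p :: 'a) * (- 1) ^ p = 1" for p by (simp flip: power_mult_distrib)
  have "M * M = 0\<^sub>m k k" "N * N = 0\<^sub>m k k"
    unfolding M_def N_def weighted_shift_mult by (auto intro!: eq_matI)
  moreover have "weighted_shift k (\<lambda>i. 1) * weighted_shift k (\<lambda>i. 1) = M * N - N * M"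
    unfolding M_def N_def weighted_shift_mult by (intro eq_matI) (auto simp: sq)
  moreover have "M \<in> carrier_mat k k" "N \<in> carrier_mat k k" unfolding M_def N_def weighted_shift_def by auto
  ultimately show ?thesis unfolding square_zero_commutator_def J by blast
qed

text \<open>A block of size 0 is empty whatever its eigenvalue, hence the disjunction in the
  hypothesis.\<close>

lemma square_zero_commutator_nilpotent_jordan_matrix_square:
  fixes xs :: "(nat \<times> 'a :: comm_ring_1) list"
  assumes "\<And>k a. (k, a) \<in> set xs \<Longrightarrow> k = 0 \<or> a = 0"
  shows "square_zero_commutator (sum_list (map fst xs)) (jordan_matrix xs * jordan_matrix xs)"
  using assms
proof (induction xs)
  case Nil
  show ?case unfolding square_zero_commutator_def
    by (intro exI[of _ "0\<^sub>m 0 0"]) (auto intro!: eq_matI)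
next
  case (Cons x xs)
  obtain k a where x: "x = (k, a)" by force
  have "jordan_block k a = jordan_block k 0"
    using Cons.prems[of k a] unfolding x by (auto intro!: eq_matI)
  then have "square_zero_commutator k (jordan_block k a * jordan_block k a)"
    using square_zero_commutator_jordan_block_square[of k, where 'a = 'a] by simp
  moreover have "square_zero_commutator (sum_list (map fst xs)) (jordan_matrix xs * jordan_matrix xs)"
    using Cons by simp
  ultimately show ?case
    using square_zero_commutator_dsum[of k _ "sum_list (map fst xs)"]
    by (simp add: x jordan_matrix_Cons_dsum dsum_mat_mult[of _ k _ _ "sum_list (map fst xs)"])
qed

lemma jordan_matrix_pow_eq_0:
  fixes xs :: "(nat \<times> 'a :: field) list"
  assumes "jordan_matrix xs ^\<^sub>m p = 0\<^sub>m (sum_list (map fst xs)) (sum_list (map fst xs))" "(k, a) \<in> set xs"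
  shows "k = 0 \<or> a = 0"
  using assms
proof (induction xs)
  case (Cons x xs)
  obtain l b where x: "x = (l, b)" by force
  let ?n = "sum_list (map fst xs)"
  have "jordan_block l b ^\<^sub>m p \<oplus>\<^sub>m jordan_matrix xs ^\<^sub>m p = 0\<^sub>m l l \<oplus>\<^sub>m 0\<^sub>m ?n ?n"
    using Cons.prems(1) by (simp add: x jordan_matrix_Cons_dsum dsum_mat_pow[of _ l _ ?n] dsum_mat_zero)
  then have 0: "jordan_block l b ^\<^sub>m p = 0\<^sub>m l l" "jordan_matrix xs ^\<^sub>m p = 0\<^sub>m ?n ?n"
    by (subst (asm) dsum_mat_eq_iff[of _ l _ _ ?n]; simp)+
  show ?case
  proof (cases "(k, a) = x")
    case True
    \<comment> \<open>The diagonal of the power is constantly a^p. For p = 0 this constant is 1,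
      which leaves only k = 0.\<close>
    then have "replicate k (a ^ p) = replicate k 0"
      using diag_jordan_block_pow[of k a p] 0(1) x by (simp add: diag_mat_def list_eq_iff_nth_eq)
    then show ?thesis by (cases "k = 0") auto
  qed (use Cons 0(2) in auto)
qed simp

lemma square_zero_commutator_nilpotent_square:
  fixes L :: "complex mat"
  assumes L: "L \<in> carrier_mat n n" and nil: "nilpotent_mat L"
  shows "square_zero_commutator n (L * L)"
proof -
  obtain p where p: "L ^\<^sub>m p = 0\<^sub>m n n" using nil L unfolding nilpotent_mat_def by auto
  obtain xs where "jordan_nf L xs" using complex_jordan_nf_exists[OF L] .
  then have sim: "similar_mat L (jordan_matrix xs)" unfolding jordan_nf_def by simp
  then obtain P Q where wit: "similar_mat_wit L (jordan_matrix xs) P Q" unfolding similar_mat_def by blast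
  note wit' = similar_mat_wit_sym[OF wit]
  have J: "jordan_matrix xs \<in> carrier_mat n n" and PQ: "P \<in> carrier_mat n n" "Q \<in> carrier_mat n n"
    using similar_mat_witD2[OF L wit] by auto
  have n: "n = sum_list (map fst xs)" using J by auto
  have "jordan_matrix xs ^\<^sub>m p = 0\<^sub>m n n"
    using similar_mat_wit_pow_id[OF wit', of p] PQ unfolding p by simp
  then have "square_zero_commutator n (jordan_matrix xs * jordan_matrix xs)"
    unfolding n by (intro square_zero_commutator_nilpotent_jordan_matrix_square jordan_matrix_pow_eq_0)
  moreover have "similar_mat (L * L) (jordan_matrix xs * jordan_matrix xs)"
    using similar_mat_wit_pow[OF wit, of 2] L J unfolding similar_mat_def by (auto simp: numeral_2_eq_2)
  ultimately show ?thesis using square_zero_commutator_similar by blast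
qed

theorem theorem3p17:
  fixes n :: nat and T :: "complex mat"
  assumes "n \<ge> 2" and "T \<in> carrier_mat n n"
  shows "(\<exists>M N. M \<in> carrier_mat n n \<and> N \<in> carrier_mat n n \<and>
            M * M = 0\<^sub>m n n \<and> N * N = 0\<^sub>m n n \<and> T = M * N - N * M)
     \<longleftrightarrow> (\<exists>k A L. 2 * k \<le> n \<and> A \<in> carrier_mat k k \<and> invertible_mat A \<and>
            L \<in> carrier_mat (n - 2 * k) (n - 2 * k) \<and> nilpotent_mat L \<and>
            similar_mat T ((A \<oplus>\<^sub>m (- A)) \<oplus>\<^sub>m (L * L)))"
proof
  assume "\<exists>M N. M \<in> carrier_mat n n \<and> N \<in> carrier_mat n n \<and>
            M * M = 0\<^sub>m n n \<and> N * N = 0\<^sub>m n n \<and> T = M * N - N * M"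
  then show "\<exists>k A L. 2 * k \<le> n \<and> A \<in> carrier_mat k k \<and> invertible_mat A \<and>
            L \<in> carrier_mat (n - 2 * k) (n - 2 * k) \<and> nilpotent_mat L \<and>
            similar_mat T ((A \<oplus>\<^sub>m (- A)) \<oplus>\<^sub>m (L * L))"
    using square_zero_commutator_imp_canonical_form unfolding square_zero_commutator_def by blast
next
  assume "\<exists>k A L. 2 * k \<le> n \<and> A \<in> carrier_mat k k \<and> invertible_mat A \<and>
            L \<in> carrier_mat (n - 2 * k) (n - 2 * k) \<and> nilpotent_mat L \<and>
            similar_mat T ((A \<oplus>\<^sub>m (- A)) \<oplus>\<^sub>m (L * L))"
  then obtain k A L where k: "2 * k \<le> n" and A: "A \<in> carrier_mat k k"
    and L: "L \<in> carrier_mat (n - 2 * k) (n - 2 * k)" "nilpotent_mat L"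
    and sim: "similar_mat T ((A \<oplus>\<^sub>m (- A)) \<oplus>\<^sub>m (L * L))"
    by blast
  have "square_zero_commutator (k + k + (n - 2 * k)) ((A \<oplus>\<^sub>m (- A)) \<oplus>\<^sub>m (L * L))"
    using A L by (intro square_zero_commutator_dsum square_zero_commutator_dsum_uminus square_zero_commutator_nilpotent_square)
  \<comment> \<open>Subtraction of naturals is truncated, so the sizes add up to \<open>n\<close> by
    the bound on \<open>k\<close>.\<close>
  moreover have "k + k + (n - 2 * k) = n" using k by simp
  ultimately have "square_zero_commutator n T"
    using square_zero_commutator_similar[OF sim] by simp
  then show "\<exists>M N. M \<in> carrier_mat n n \<and> N \<in> carrier_mat n n \<and>
            M * M = 0\<^sub>m n n \<and> N * N = 0\<^sub>m n n \<and> T = M * N - N * M"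
    unfolding square_zero_commutator_def .
qed

end
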